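(* Let $g \in L^2(\mathbb{R}^d)$ and let $T, S \subset \mathbb{R}^d$ be two countable sets such that the Gabor system $$\mathbf{G}(g,T,S) = \{ g(x-t)\, e^{2\pi i \langle s, x\rangle} : t \in T,\ s \in S\}$$ is an orthonormal basis in $L^2(\mathbb{R}^d)$. Then both $g$ and $\widehat{g}$ must belong to $L^\infty(\mathbb{R}^d)$, and moreover $$\|g\|_{L^\infty(\mathbb{R}^d)} \leq \sqrt{D(T)}, \qquad \|\widehat{g}\|_{L^\infty(\mathbb{R}^d)} \leq \sqrt{D(S)},$$ where $D(T)$ and $D(S)$ denote the uniform densities of $T$ and $S$, respectively.
   Context: The Gabor system $\mathbf{G}(g,T,S)$ is the family of functions of $x \in \mathbb{R}^d$ indexed by the pairs $(t,s) \in T \times S$; $g$ is complex-valued. The Fourier transform is $\widehat{g}(\xi) = \int_{\mathbb{R}^d} g(x) e^{-2\pi i \langle \xi, x\rangle}\,dx$ (extended to $L^2(\mathbb{R}^d)$ as a unitary operator in the usual way). A set $\Lambda \subset \mathbb{R}^d$ is said to be uniformly distributed if there exists a number $D(\Lambda)$ such that $$\frac{\#(\Lambda \cap (x + [0,r]^d))}{r^d} = D(\Lambda) + o(1), \quad r \to +\infty,$$ uniformly with respect to $x \in \mathbb{R}^d$; in this case $D(\Lambda)$ is called the uniform density of $\Lambda$. It is a previously known fact (Liu and Wang, "The uniformity of non-uniform Gabor bases", Lemma 2.2) that if $\mathbf{G}(g,T,S)$ is an orthonormal basis in $L^2(\mathbb{R}^d)$ then both $T$ and $S$ are uniformly distributed,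 and their uniform densities are positive and finite numbers satisfying $D(T)D(S) = 1$. Thus $D(T)$ and $D(S)$ are well defined in the claim. *)

theory Defs
  imports "HOL-Analysis.Analysis" "HOL-Probability.Essential_Supremum"
begin

section \<open>The spaces \<open>L\<^sup>2\<close> and \<open>L\<^sup>\<infinity>\<close> on \<open>\<real>\<^sup>d\<close>\<close>

text \<open>Elements of \<open>L\<^sup>2\<close> and \<open>L\<^sup>\<infinity>\<close> are represented by Lebesgue measurable functions rather than
  by classes modulo equality almost everywhere.\<close>

definition L2_space :: "(real ^ 'd \<Rightarrow> complex) set" where
  "L2_space = {f. f \<in> borel_measurable lebesgue \<and> integrable lebesgue (\<lambda>x. (cmod (f x))\<^sup>2)}"

definition L2_inner :: "(real ^ 'd \<Rightarrow> complex) \<Rightarrow> (real ^ 'd \<Rightarrow> complex) \<Rightarrow> complex" where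
  "L2_inner f h = (\<integral>x. f x * cnj (h x) \<partial>lebesgue)"

text \<open>Only meaningful on \<^const>\<open>L2_space\<close>: the Bochner integral of a non-integrable function is 0.\<close>

definition L2_norm :: "(real ^ 'd \<Rightarrow> complex) \<Rightarrow> real" where
  "L2_norm f = sqrt (\<integral>x. (cmod (f x))\<^sup>2 \<partial>lebesgue)"

definition Linf_norm :: "(real ^ 'd \<Rightarrow> complex) \<Rightarrow> ereal" where
  "Linf_norm f = esssup lebesgue (\<lambda>x. ereal (cmod (f x)))"

definition Linf_space :: "(real ^ 'd \<Rightarrow> complex) set" where
  "Linf_space = {f. f \<in> borel_measurable lebesgue \<and> Linf_norm f < \<infinity>}"

text \<open>An orthonormal family, indexed by \<open>I\<close>, whose finite linear combinations are dense in \<open>L\<^sup>2\<close>.\<close>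

definition L2_orthonormal_basis :: "'i set \<Rightarrow> ('i \<Rightarrow> real ^ 'd \<Rightarrow> complex) \<Rightarrow> bool" where
  "L2_orthonormal_basis I \<phi> \<longleftrightarrow>
     (\<forall>i\<in>I. \<phi> i \<in> L2_space) \<and>
     (\<forall>i\<in>I. \<forall>j\<in>I. L2_inner (\<phi> i) (\<phi> j) = (if i = j then 1 else 0)) \<and>
     (\<forall>f\<in>L2_space. \<forall>\<epsilon>>0. \<exists>F c. finite F \<and> F \<subseteq> I \<and>
        L2_norm (\<lambda>x. f x - (\<Sum>i\<in>F. c i * \<phi> i x)) < \<epsilon>)"

section \<open>Gabor systems\<close>

definition gabor ::
  "(real ^ 'd \<Rightarrow> complex) \<Rightarrow> (real ^ 'd) \<times> (real ^ 'd) \<Rightarrow> real ^ 'd \<Rightarrow> complex" where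
  "gabor g = (\<lambda>(t, s) x. g (x - t) * exp (2 * complex_of_real pi * \<i> * complex_of_real (s \<bullet> x)))"

section \<open>Fourier transform\<close>

definition fourier_L1 :: "(real ^ 'd \<Rightarrow> complex) \<Rightarrow> real ^ 'd \<Rightarrow> complex" where
  "fourier_L1 f \<xi> =
     (\<integral>x. f x * exp (- 2 * complex_of_real pi * \<i> * complex_of_real (\<xi> \<bullet> x)) \<partial>lebesgue)"

text \<open>Extension by continuity from the dense subspace \<open>L\<^sup>1 \<inter> L\<^sup>2\<close>: \<open>h\<close> represents the Fourier
  transform of \<open>g\<close> if it is the \<open>L\<^sup>2\<close>-limit of the transforms of some functions in \<open>L\<^sup>1 \<inter> L\<^sup>2\<close>
  that converge to \<open>g\<close> in \<open>L\<^sup>2\<close>. By Plancherel's theorem such an \<open>h\<close> exists for every \<open>g\<close> in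
  \<open>L\<^sup>2\<close>, does not depend on the approximating sequence up to null sets, and the membership of
  \<open>fourier_L1 (f n)\<close> in \<open>L\<^sup>2\<close> is automatic; it is spelled out because of the caveat
  on \<^const>\<open>L2_norm\<close>.\<close>

definition is_fourier_L2 :: "(real ^ 'd \<Rightarrow> complex) \<Rightarrow> (real ^ 'd \<Rightarrow> complex) \<Rightarrow> bool" where
  "is_fourier_L2 g h \<longleftrightarrow> h \<in> L2_space \<and>
     (\<exists>f :: nat \<Rightarrow> real ^ 'd \<Rightarrow> complex.
        (\<forall>n. f n \<in> L2_space \<and> integrable lebesgue (f n) \<and> fourier_L1 (f n) \<in> L2_space) \<and>
        (\<lambda>n. L2_norm (\<lambda>x. f n x - g x)) \<longlonglongrightarrow> 0 \<and>
        (\<lambda>n. L2_norm (\<lambda>\<xi>. fourier_L1 (f n) \<xi> - h \<xi>)) \<longlonglongrightarrow> 0)"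

definition fourier_L2 :: "(real ^ 'd \<Rightarrow> complex) \<Rightarrow> real ^ 'd \<Rightarrow> complex" where
  "fourier_L2 g = (SOME h. is_fourier_L2 g h)"

section \<open>Uniform density\<close>

text \<open>The finiteness clause is needed because \<^const>\<open>card\<close> of an infinite set is 0. It may be
  required of all cubes, since each is contained in arbitrarily large ones.\<close>

definition has_uniform_density :: "(real ^ 'd) set \<Rightarrow> real \<Rightarrow> bool" where
  "has_uniform_density \<Lambda> D \<longleftrightarrow>
     (\<forall>x r. finite (\<Lambda> \<inter> cbox x (x + (\<chi> i. r)))) \<and>
     uniform_limit UNIV
       (\<lambda>r x. real (card (\<Lambda> \<inter> cbox x (x + (\<chi> i. r)))) / r ^ CARD('d)) (\<lambda>x. D) at_top"

definition uniform_density :: "(real ^ 'd) set \<Rightarrow> real" where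
  "uniform_density \<Lambda> = (THE D. has_uniform_density \<Lambda> D)"

lemma has_uniform_density_unique:
  fixes \<Lambda> :: "(real ^ 'd) set"
  assumes "has_uniform_density \<Lambda> D" "has_uniform_density \<Lambda> D'"
  shows "D = D'"
proof -
  let ?N = "\<lambda>r x. real (card (\<Lambda> \<inter> cbox x (x + (\<chi> i. r)))) / r ^ CARD('d)"
  have "((\<lambda>r. ?N r 0) \<longlongrightarrow> D) at_top" "((\<lambda>r. ?N r 0) \<longlongrightarrow> D') at_top"
    using assms tendsto_uniform_limitI[where f = ?N and S = UNIV and x = 0 and F = at_top]
    unfolding has_uniform_density_def by blast+
  then show ?thesis
    by (rule tendsto_unique[OF trivial_limit_at_top_linorder])
qed

lemma uniform_density_eqI: "has_uniform_density \<Lambda> D \<Longrightarrow> uniform_density \<Lambda> = D"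
  unfolding uniform_density_def by (blast intro: has_uniform_density_unique)

end

theory Submission
  imports Defs "HOL-Probability.Characteristic_Functions"
begin

text \<open>
  Write \<open>M\<^sub>s h\<close> for the modulation of \<open>h\<close> by the exponential of frequency \<open>s\<close> and \<open>T\<^sub>t h\<close> for its
  translation by \<open>t\<close>; the Gabor system consists of the functions \<open>M\<^sub>s T\<^sub>t g\<close>. The proof combines two
  averaging arguments.

  The densities. Let \<open>f\<close> be the indicator of the unit cube, a vector of norm 1, and put
  \<open>\<phi> (u, v) = \<bar>\<langle>f, M\<^sub>v T\<^sub>u g\<rangle>\<bar>\<^sup>2\<close>. Parseval's identity for \<open>M\<^sub>b T\<^sub>a f\<close> says that the sum of
  \<open>\<phi> (t - a, s - b)\<close> over \<open>T \<times> S\<close> is 1 for all \<open>(a, b)\<close>, and Plancherel's theorem in \<open>v\<close> followed by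
  integration in \<open>u\<close> gives \<open>\<phi>\<close> total mass 1. Integrating the periodization over a product of two
  cubes, of sides \<open>r\<close> and \<open>R\<close>, and interchanging sum and integral shows that the product
  \<open>#(T \<inter> (x + u + [0,r]\<^sup>d)) #(S \<inter> (y + v + [0,R]\<^sup>d))\<close> has \<open>\<phi>\<close>-average \<open>r\<^sup>d R\<^sup>d\<close>
  (\<open>averaged_periodization\<close>, \<open>gabor_averaged_counts\<close>). As most of the mass of \<open>\<phi>\<close> lies in a bounded
  set, whose shifts are negligible for large cubes, the product of the counts is asymptotic to
  \<open>r\<^sup>d R\<^sup>d\<close>, uniformly in the positions. Since \<open>r\<close> and \<open>R\<close> vary independently, each factor has a
  uniform density, and \<open>D(T) D(S) = 1\<close> (\<open>averaged_counts.densities\<close>).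

  The sup bounds. Suppose that the functions \<open>M\<^sub>s h\<close>, \<open>s \<in> \<Lambda>\<close>, are orthonormal. Bessel's inequality
  for all modulations of the indicator of a bounded set \<open>E\<close>, averaged over a large cube of
  modulation parameters, together with Plancherel's theorem for \<open>1\<^sub>E\<close> times the conjugate of \<open>h\<close>,
  gives \<open>D(\<Lambda>) \<integral>\<^sub>E \<bar>h\<bar>\<^sup>2 \<le> \<bar>E\<bar>\<close>. Hence the set where \<open>\<bar>h\<bar>\<^sup>2 > 1 / D(\<Lambda>)\<close> is null
  (\<open>AE_bound_of_averaged_Bessel\<close>). For \<open>h = g\<close> and \<open>\<Lambda> = S\<close> this is the bound \<open>1 / D(S) = D(T)\<close> for
  \<open>\<bar>g\<bar>\<^sup>2\<close>. The Fourier transform carries the orthonormal translates \<open>T\<^sub>t g\<close> to modulations of the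
  transform of \<open>g\<close> (\<open>fourier_L2_inner_translates\<close>), so that the same lemma with \<open>\<Lambda> = T\<close> bounds the
  squared modulus of the transform by \<open>1 / D(T) = D(S)\<close>.

  Plancherel's theorem is obtained by integrating the squared modulus of the transform of \<open>f\<close>, which
  is itself the transform of the autocorrelation of \<open>f\<close>, against wider and wider Gaussian weights; it extends
  to \<open>L\<^sup>2\<close> by the completeness of that space.
\<close>

section \<open>Square integrable functions\<close>

text \<open>The completed measure on a product space is not the product of the completed measures, so iterated
  integrals are taken of Borel functions with respect to \<^const>\<open>lborel\<close>. Nothing is lost, because a class
  modulo equality almost everywhere always contains a Borel function.\<close>

lemma L2_borel_representative:
  assumes "f \<in> L2_space"
  obtains f' where "f' \<in> borel_measurable borel" "f' \<in> L2_space" "AE x in lebesgue. f x = f' x"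
proof -
  have m: "f \<in> borel_measurable lebesgue" and i: "integrable lebesgue (\<lambda>x. (cmod (f x))\<^sup>2)"
    using assms by (auto simp: L2_space_def)
  obtain a where a: "a \<in> borel_measurable lborel" "AE x in lborel. Re (f x) = a x"
    using completion_ex_borel_measurable_real[of "\<lambda>x. Re (f x)" lborel] m by auto
  obtain b where b: "b \<in> borel_measurable lborel" "AE x in lborel. Im (f x) = b x"
    using completion_ex_borel_measurable_real[of "\<lambda>x. Im (f x)" lborel] m by auto
  define f' where "f' x = Complex (a x) (b x)" for x
  have f'_alt: "f' = (\<lambda>x. complex_of_real (a x) + \<i> * complex_of_real (b x))"
    by (auto simp: f'_def complex_eq_iff)
  have f'm: "f' \<in> borel_measurable borel"
    using a(1) b(1) unfolding f'_alt by auto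
  have "AE x in lborel. f x = f' x"
    using a(2) b(2) by eventually_elim (auto simp: f'_def complex_eq_iff)
  then have ae: "AE x in lebesgue. f x = f' x"
    by (rule AE_completion)
  have f'ml: "f' \<in> borel_measurable lebesgue"
    using f'm by (simp add: measurable_completion)
  have "integrable lebesgue (\<lambda>x. (cmod (f' x))\<^sup>2)"
    by (rule integrable_cong_AE_imp[OF i]) (use f'ml ae in \<open>auto elim: eventually_mono\<close>)
  with f'ml have "f' \<in> L2_space" by (simp add: L2_space_def)
  with f'm ae show ?thesis using that by blast
qed

lemma borel_measurable_cnj [measurable (raw)]:
  "f \<in> borel_measurable M \<Longrightarrow> (\<lambda>x. cnj (f x)) \<in> borel_measurable M"
  by (rule borel_measurable_continuous_on[OF continuous_on_cnj[OF continuous_on_id]])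

lemma L2_inner_cong_AE:
  assumes "f \<in> L2_space" "f' \<in> L2_space" "h \<in> L2_space" "h' \<in> L2_space"
    and ae: "AE x in lebesgue. f x = f' x" "AE x in lebesgue. h x = h' x"
  shows "L2_inner f h = L2_inner f' h'"
  unfolding L2_inner_def
proof (rule integral_cong_AE)
  show "(\<lambda>x. f x * cnj (h x)) \<in> borel_measurable lebesgue"
    "(\<lambda>x. f' x * cnj (h' x)) \<in> borel_measurable lebesgue"
    using assms unfolding L2_space_def by (auto intro!: borel_measurable_times borel_measurable_cnj)
  show "AE x in lebesgue. f x * cnj (h x) = f' x * cnj (h' x)"
    using ae by eventually_elim auto
qed

lemma L2_inner_integrable:
  assumes "f \<in> L2_space" "h \<in> L2_space"
  shows "integrable lebesgue (\<lambda>x. f x * cnj (h x))"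
proof (rule Bochner_Integration.integrable_bound[where f = "\<lambda>x. (cmod (f x))\<^sup>2 + (cmod (h x))\<^sup>2"])
  show "integrable lebesgue (\<lambda>x. (cmod (f x))\<^sup>2 + (cmod (h x))\<^sup>2)"
    using assms by (auto simp: L2_space_def)
  show "(\<lambda>x. f x * cnj (h x)) \<in> borel_measurable lebesgue"
    using assms unfolding L2_space_def by (auto intro!: borel_measurable_times borel_measurable_cnj)
  have "cmod (f x) * cmod (h x) \<le> (cmod (f x))\<^sup>2 + (cmod (h x))\<^sup>2" for x
    using sum_squares_bound[of "cmod (f x)" "cmod (h x)"]
      mult_nonneg_nonneg[OF norm_ge_zero norm_ge_zero, of "f x" "h x"] by linarith
  then show "AE x in lebesgue. norm (f x * cnj (h x)) \<le> norm ((cmod (f x))\<^sup>2 + (cmod (h x))\<^sup>2)"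
    by (auto simp: norm_mult)
qed

lemma L2_zero [simp]: "(\<lambda>x. 0) \<in> L2_space"
  by (simp add: L2_space_def)

lemma L2_add [intro]:
  assumes "f \<in> L2_space" "h \<in> L2_space"
  shows "(\<lambda>x. f x + h x) \<in> L2_space"
proof -
  have "integrable lebesgue (\<lambda>x. (cmod (f x + h x))\<^sup>2)"
  proof (rule Bochner_Integration.integrable_bound[where f = "\<lambda>x. 2 * (cmod (f x))\<^sup>2 + 2 * (cmod (h x))\<^sup>2"])
    have "(cmod (f x + h x))\<^sup>2 \<le> 2 * (cmod (f x))\<^sup>2 + 2 * (cmod (h x))\<^sup>2" for x
    proof -
      have "(cmod (f x + h x))\<^sup>2 \<le> (cmod (f x) + cmod (h x))\<^sup>2"
        by (intro power_mono norm_triangle_ineq norm_ge_zero)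
      also have "\<dots> \<le> 2 * (cmod (f x))\<^sup>2 + 2 * (cmod (h x))\<^sup>2"
        using sum_squares_bound[of "cmod (f x)" "cmod (h x)"] by (simp add: power2_sum)
      finally show ?thesis .
    qed
    then show "AE x in lebesgue. norm ((cmod (f x + h x))\<^sup>2) \<le> norm (2 * (cmod (f x))\<^sup>2 + 2 * (cmod (h x))\<^sup>2)"
      by auto
  qed (use assms in \<open>auto simp: L2_space_def\<close>)
  with assms show ?thesis by (auto simp: L2_space_def)
qed

lemma L2_scale [intro]:
  assumes "f \<in> L2_space"
  shows "(\<lambda>x. c * f x) \<in> L2_space"
  using assms by (auto simp: L2_space_def norm_mult power_mult_distrib)

lemma L2_diff [intro]:
  assumes "f \<in> L2_space" "h \<in> L2_space"
  shows "(\<lambda>x. f x - h x) \<in> L2_space"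
  using L2_add[OF assms(1) L2_scale[OF assms(2), of "-1"]] by simp

lemma L2_sum [intro]:
  assumes "\<And>i. i \<in> F \<Longrightarrow> \<phi> i \<in> L2_space"
  shows "(\<lambda>x. \<Sum>i\<in>F. \<phi> i x) \<in> L2_space"
  using assms by (induction F rule: infinite_finite_induct) auto

lemma L2_norm_nonneg [simp]: "L2_norm f \<ge> 0"
  by (simp add: L2_norm_def)

lemma L2_norm_power2: "(L2_norm f)\<^sup>2 = (\<integral>x. (cmod (f x))\<^sup>2 \<partial>lebesgue)"
  by (simp add: L2_norm_def)

lemma L2_inner_self: "L2_inner f f = complex_of_real ((L2_norm f)\<^sup>2)"
  by (simp add: L2_inner_def L2_norm_power2 complex_norm_square[symmetric] flip: integral_complex_of_real)

lemma L2_inner_commute: "L2_inner h f = cnj (L2_inner f h)"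
proof -
  have "cnj (L2_inner f h) = (\<integral>x. cnj (f x * cnj (h x)) \<partial>lebesgue)"
    unfolding L2_inner_def by (rule Bochner_Integration.integral_cnj[symmetric])
  then show ?thesis by (simp add: L2_inner_def mult.commute)
qed

lemma L2_inner_diff_left:
  assumes "f \<in> L2_space" "f' \<in> L2_space" "h \<in> L2_space"
  shows "L2_inner (\<lambda>x. f x - f' x) h = L2_inner f h - L2_inner f' h"
  using L2_inner_integrable[OF assms(1,3)] L2_inner_integrable[OF assms(2,3)]
  by (simp add: L2_inner_def left_diff_distrib)

lemma L2_inner_diff_right:
  assumes "f \<in> L2_space" "f' \<in> L2_space" "h \<in> L2_space"
  shows "L2_inner h (\<lambda>x. f x - f' x) = L2_inner h f - L2_inner h f'"
  using L2_inner_diff_left[OF assms] by (metis L2_inner_commute complex_cnj_diff)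

lemma L2_inner_sum_left:
  assumes "\<And>i. i \<in> F \<Longrightarrow> \<phi> i \<in> L2_space" "h \<in> L2_space"
  shows "L2_inner (\<lambda>x. \<Sum>i\<in>F. c i * \<phi> i x) h = (\<Sum>i\<in>F. c i * L2_inner (\<phi> i) h)"
proof -
  have "L2_inner (\<lambda>x. \<Sum>i\<in>F. c i * \<phi> i x) h = (\<integral>x. (\<Sum>i\<in>F. c i * (\<phi> i x * cnj (h x))) \<partial>lebesgue)"
    by (simp add: L2_inner_def sum_distrib_right mult.assoc)
  also have "\<dots> = (\<Sum>i\<in>F. c i * L2_inner (\<phi> i) h)"
    using L2_inner_integrable[OF assms(1) assms(2)]
    by (subst Bochner_Integration.integral_sum) (auto simp: L2_inner_def)
  finally show ?thesis .
qed

lemma L2_inner_scale_left: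
  "L2_inner (\<lambda>x. c * f x) h = c * L2_inner f h"
  by (simp add: L2_inner_def mult.assoc)

lemma L2_norm_diff_power2:
  assumes "f \<in> L2_space" "h \<in> L2_space"
  shows "(L2_norm (\<lambda>x. f x - h x))\<^sup>2 = (L2_norm f)\<^sup>2 + (L2_norm h)\<^sup>2 - 2 * Re (L2_inner f h)"
proof -
  have "complex_of_real ((L2_norm (\<lambda>x. f x - h x))\<^sup>2) = L2_inner (\<lambda>x. f x - h x) (\<lambda>x. f x - h x)"
    by (simp only: L2_inner_self)
  also have "\<dots> = L2_inner f f + L2_inner h h - (L2_inner f h + cnj (L2_inner f h))"
    using assms L2_inner_commute[of h f]
    by (simp add: L2_inner_diff_left L2_inner_diff_right L2_diff)
  also have "\<dots> = complex_of_real ((L2_norm f)\<^sup>2 + (L2_norm h)\<^sup>2 - 2 * Re (L2_inner f h))"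
    by (simp add: L2_inner_self complex_add_cnj)
  finally show ?thesis by (simp only: of_real_eq_iff)
qed

lemma L2_Cauchy_Schwarz:
  assumes "f \<in> L2_space" "h \<in> L2_space"
  shows "cmod (L2_inner f h) \<le> L2_norm f * L2_norm h"
proof -
  have [measurable]: "f \<in> borel_measurable lebesgue" "h \<in> borel_measurable lebesgue"
    and i: "integrable lebesgue (\<lambda>x. (cmod (f x))\<^sup>2)" "integrable lebesgue (\<lambda>x. (cmod (h x))\<^sup>2)"
    using assms by (auto simp: L2_space_def)
  let ?I = "\<integral>x. cmod (f x) * cmod (h x) \<partial>lebesgue"
  have ifh: "integrable lebesgue (\<lambda>x. cmod (f x) * cmod (h x))"
    using integrable_norm[OF L2_inner_integrable[OF assms]] by (simp add: norm_mult)
  have "ennreal (?I\<^sup>2) = (\<integral>\<^sup>+x. ennreal (cmod (f x)) * ennreal (cmod (h x)) \<partial>lebesgue)\<^sup>2"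
    using ifh by (simp add: nn_integral_eq_integral ennreal_power flip: ennreal_mult)
  also have "\<dots> \<le> (\<integral>\<^sup>+x. (ennreal (cmod (f x)))\<^sup>2 \<partial>lebesgue) * (\<integral>\<^sup>+x. (ennreal (cmod (h x)))\<^sup>2 \<partial>lebesgue)"
    by (rule Cauchy_Schwarz_nn_integral) auto
  also have "\<dots> = ennreal ((L2_norm f * L2_norm h)\<^sup>2)"
    using i by (simp add: nn_integral_eq_integral ennreal_power power_mult_distrib L2_norm_power2 flip: ennreal_mult)
  finally have "?I\<^sup>2 \<le> (L2_norm f * L2_norm h)\<^sup>2"
    by simp
  then have "?I \<le> L2_norm f * L2_norm h"
    by (rule power2_le_imp_le) simp
  moreover have "cmod (L2_inner f h) \<le> ?I"
    unfolding L2_inner_def using integral_norm_bound[of lebesgue "\<lambda>x. f x * cnj (h x)"] by (simp add: norm_mult)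
  ultimately show ?thesis by simp
qed

lemma L2_norm_minus_commute: "L2_norm (\<lambda>x. f x - h x) = L2_norm (\<lambda>x. h x - f x)"
  by (simp add: L2_norm_def norm_minus_commute)

lemma L2_norm_triangle_diff:
  assumes "f \<in> L2_space" "h \<in> L2_space"
  shows "L2_norm (\<lambda>x. f x - h x) \<le> L2_norm f + L2_norm h"
proof (rule power2_le_imp_le)
  have "- Re (L2_inner f h) \<le> L2_norm f * L2_norm h"
    using L2_Cauchy_Schwarz[OF assms] abs_Re_le_cmod[of "L2_inner f h"] by linarith
  then show "(L2_norm (\<lambda>x. f x - h x))\<^sup>2 \<le> (L2_norm f + L2_norm h)\<^sup>2"
    by (simp add: L2_norm_diff_power2[OF assms] power2_sum)
qed simp

lemma L2_dist_triangle:
  assumes "f \<in> L2_space" "h \<in> L2_space" "k \<in> L2_space"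
  shows "L2_norm (\<lambda>x. f x - h x) \<le> L2_norm (\<lambda>x. f x - k x) + L2_norm (\<lambda>x. k x - h x)"
  using L2_norm_triangle_diff[OF L2_diff[OF assms(1,3)] L2_diff[OF assms(2,3)]]
    L2_norm_minus_commute[of h k] by simp

lemma L2_norm_reverse_triangle:
  assumes "f \<in> L2_space" "h \<in> L2_space"
  shows "\<bar>L2_norm f - L2_norm h\<bar> \<le> L2_norm (\<lambda>x. f x - h x)"
  using L2_dist_triangle[OF assms(1) L2_zero assms(2)] L2_dist_triangle[OF assms(2) L2_zero assms(1)]
    L2_norm_minus_commute[of f h] by simp

text \<open>Joint continuity of the inner product, from the Cauchy-Schwarz inequality. It moves orthogonality
  relations through the \<open>L\<^sup>2\<close> limits that define the Fourier transform.\<close>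

lemma L2_inner_tendsto:
  assumes "\<And>n. f n \<in> L2_space" "\<And>n. h n \<in> L2_space" "f' \<in> L2_space" "h' \<in> L2_space"
    and f: "(\<lambda>n. L2_norm (\<lambda>x. f n x - f' x)) \<longlonglongrightarrow> 0"
    and h: "(\<lambda>n. L2_norm (\<lambda>x. h n x - h' x)) \<longlonglongrightarrow> 0"
  shows "(\<lambda>n. L2_inner (f n) (h n)) \<longlonglongrightarrow> L2_inner f' h'"
proof (rule LIM_zero_cancel, rule Lim_null_comparison)
  let ?a = "\<lambda>n. L2_norm (\<lambda>x. f n x - f' x)" and ?b = "\<lambda>n. L2_norm (\<lambda>x. h n x - h' x)"
  show "\<forall>\<^sub>F n in sequentially. norm (L2_inner (f n) (h n) - L2_inner f' h') \<le>
      ?a n * (?b n + L2_norm h') + L2_norm f' * ?b n"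
  proof (rule always_eventually, rule allI)
    fix n
    have "L2_inner (f n) (h n) - L2_inner f' h' =
        L2_inner (\<lambda>x. f n x - f' x) (h n) + L2_inner f' (\<lambda>x. h n x - h' x)"
      using assms by (simp add: L2_inner_diff_left L2_inner_diff_right)
    also have "norm \<dots> \<le> ?a n * L2_norm (h n) + L2_norm f' * ?b n"
      by (intro norm_triangle_le add_mono L2_Cauchy_Schwarz L2_diff assms)
    also have "\<dots> \<le> ?a n * (?b n + L2_norm h') + L2_norm f' * ?b n"
      using L2_norm_reverse_triangle[of "h n" h'] assms
      by (intro add_mono mult_left_mono) (auto simp: abs_le_iff)
    finally show "norm (L2_inner (f n) (h n) - L2_inner f' h') \<le>
      ?a n * (?b n + L2_norm h') + L2_norm f' * ?b n" .
  qed
  show "(\<lambda>n. ?a n * (?b n + L2_norm h') + L2_norm f' * ?b n) \<longlonglongrightarrow> 0"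
    by (auto intro!: tendsto_eq_intros f h)
qed

section \<open>Bessel's inequality and Parseval's identity\<close>

text \<open>Pythagoras' theorem. The coefficients \<open>c i = L2_inner f (\<phi> i)\<close> yield Bessel's inequality, whereas
  an arbitrary good approximation of \<open>f\<close> bounds the defect in that inequality, which yields
  Parseval's identity.\<close>

lemma L2_dist_orthonormal_combination:
  assumes "finite F" and f: "f \<in> L2_space" and \<phi>: "\<And>i. i \<in> F \<Longrightarrow> \<phi> i \<in> L2_space"
    and on: "\<And>i j. i \<in> F \<Longrightarrow> j \<in> F \<Longrightarrow> L2_inner (\<phi> i) (\<phi> j) = (if i = j then 1 else 0)"
  shows "(L2_norm (\<lambda>x. f x - (\<Sum>i\<in>F. c i * \<phi> i x)))\<^sup>2 =
    (L2_norm f)\<^sup>2 - (\<Sum>i\<in>F. (cmod (L2_inner f (\<phi> i)))\<^sup>2) + (\<Sum>i\<in>F. (cmod (c i - L2_inner f (\<phi> i)))\<^sup>2)"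
proof -
  let ?h = "\<lambda>x. \<Sum>i\<in>F. c i * \<phi> i x"
  have h: "?h \<in> L2_space" by (intro L2_sum L2_scale \<phi>)
  have inner_h: "L2_inner k ?h = (\<Sum>i\<in>F. cnj (c i) * L2_inner k (\<phi> i))" if "k \<in> L2_space" for k
  proof -
    have "L2_inner k ?h = cnj (L2_inner ?h k)" by (rule L2_inner_commute)
    also have "\<dots> = (\<Sum>i\<in>F. cnj (c i) * cnj (L2_inner (\<phi> i) k))"
      using \<phi> that by (simp add: L2_inner_sum_left)
    finally show ?thesis by (simp add: L2_inner_commute[symmetric])
  qed
  have "L2_inner (\<phi> i) ?h = cnj (c i)" if "i \<in> F" for i
    using that \<open>finite F\<close> by (simp add: inner_h \<phi> on if_distrib[where f = "\<lambda>z. _ * z"] cong: if_cong)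
  then have "L2_inner ?h ?h = (\<Sum>i\<in>F. c i * cnj (c i))"
    using \<phi> h by (simp add: L2_inner_sum_left)
  then have "complex_of_real ((L2_norm ?h)\<^sup>2) = complex_of_real (\<Sum>i\<in>F. (cmod (c i))\<^sup>2)"
    by (simp only: L2_inner_self complex_norm_square of_real_sum)
  then have hh: "(L2_norm ?h)\<^sup>2 = (\<Sum>i\<in>F. (cmod (c i))\<^sup>2)"
    by (simp only: of_real_eq_iff)
  have e: "(cmod (c i - a))\<^sup>2 = (cmod (c i))\<^sup>2 + (cmod a)\<^sup>2 - 2 * Re (cnj (c i) * a)" for i a
    unfolding cmod_power2 by (simp add: power2_eq_square algebra_simps)
  show ?thesis
    unfolding L2_norm_diff_power2[OF f h] hh inner_h[OF f] e
    by (simp add: sum.distrib sum_subtractf sum_distrib_left)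
qed

lemma L2_Bessel:
  assumes "finite F" "f \<in> L2_space" "\<And>i. i \<in> F \<Longrightarrow> \<phi> i \<in> L2_space"
    and "\<And>i j. i \<in> F \<Longrightarrow> j \<in> F \<Longrightarrow> L2_inner (\<phi> i) (\<phi> j) = (if i = j then 1 else 0)"
  shows "(\<Sum>i\<in>F. (cmod (L2_inner f (\<phi> i)))\<^sup>2) \<le> (L2_norm f)\<^sup>2"
proof -
  let ?c = "\<lambda>i. L2_inner f (\<phi> i)"
  have "0 \<le> (L2_norm (\<lambda>x. f x - (\<Sum>i\<in>F. ?c i * \<phi> i x)))\<^sup>2" by simp
  also have "\<dots> = (L2_norm f)\<^sup>2 - (\<Sum>i\<in>F. (cmod (?c i))\<^sup>2)"
    by (subst L2_dist_orthonormal_combination[OF assms]) simp_all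
  finally show ?thesis by simp
qed

text \<open>Sums over a countable index set are integrals with respect to the counting measure, which allows
  their interchange with integrals over \<^const>\<open>lborel\<close> without any summability condition.\<close>

lemma nn_integral_count_space_le:
  fixes a :: "'i \<Rightarrow> ennreal"
  assumes "countable I" and le: "\<And>F. finite F \<Longrightarrow> F \<subseteq> I \<Longrightarrow> (\<Sum>i\<in>F. a i) \<le> B"
  shows "(\<integral>\<^sup>+i. a i \<partial>count_space I) \<le> B"
proof (cases "finite I")
  case True
  then show ?thesis by (simp add: nn_integral_count_space_finite le)
next
  case False
  then have bij: "bij_betw (from_nat_into I) UNIV I"
    using \<open>countable I\<close> by (rule bij_betw_from_nat_into[rotated])
  have "(\<integral>\<^sup>+i. a i \<partial>count_space I) = (\<Sum>n. a (from_nat_into I n))"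
    by (simp add: nn_integral_bij_count_space[OF bij, symmetric] nn_integral_count_space_nat)
  also have "\<dots> \<le> B"
  proof (rule suminf_le_const)
    fix n
    have inj: "inj_on (from_nat_into I) {..<n}"
      using bij by (auto simp: bij_betw_def intro: inj_on_subset)
    have "(\<Sum>k<n. a (from_nat_into I k)) = (\<Sum>i\<in>from_nat_into I ` {..<n}. a i)"
      by (simp add: sum.reindex[OF inj])
    also have "\<dots> \<le> B"
      using bij by (intro le) (auto simp: bij_betw_def)
    finally show "(\<Sum>k<n. a (from_nat_into I k)) \<le> B" .
  qed simp
  finally show ?thesis .
qed

lemma L2_Parseval:
  assumes "countable I" and onb: "L2_orthonormal_basis I \<phi>" and f: "f \<in> L2_space"
  shows "(\<integral>\<^sup>+i. ennreal ((cmod (L2_inner f (\<phi> i)))\<^sup>2) \<partial>count_space I) = ennreal ((L2_norm f)\<^sup>2)"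
    (is "?S = _")
proof (rule antisym)
  have \<phi>: "\<And>i. i \<in> I \<Longrightarrow> \<phi> i \<in> L2_space"
    and on: "\<And>i j. i \<in> I \<Longrightarrow> j \<in> I \<Longrightarrow> L2_inner (\<phi> i) (\<phi> j) = (if i = j then 1 else 0)"
    using onb by (auto simp: L2_orthonormal_basis_def)
  show "?S \<le> ennreal ((L2_norm f)\<^sup>2)"
  proof (rule nn_integral_count_space_le[OF \<open>countable I\<close>])
    fix F assume F: "finite F" "F \<subseteq> I"
    then have "(\<Sum>i\<in>F. (cmod (L2_inner f (\<phi> i)))\<^sup>2) \<le> (L2_norm f)\<^sup>2"
      by (intro L2_Bessel f \<phi> on) auto
    then show "(\<Sum>i\<in>F. ennreal ((cmod (L2_inner f (\<phi> i)))\<^sup>2)) \<le> ennreal ((L2_norm f)\<^sup>2)"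
      by (simp add: sum_ennreal ennreal_leI)
  qed
  show "ennreal ((L2_norm f)\<^sup>2) \<le> ?S"
  proof (rule ennreal_le_epsilon)
    fix e :: real assume "e > 0"
    then have "sqrt e > 0" by simp
    then obtain F c where F: "finite F" "F \<subseteq> I"
      and less: "L2_norm (\<lambda>x. f x - (\<Sum>i\<in>F. c i * \<phi> i x)) < sqrt e"
      using onb f unfolding L2_orthonormal_basis_def by meson
    have "(L2_norm (\<lambda>x. f x - (\<Sum>i\<in>F. c i * \<phi> i x)))\<^sup>2 < (sqrt e)\<^sup>2"
      by (rule power_strict_mono[OF less]) auto
    moreover have "(L2_norm (\<lambda>x. f x - (\<Sum>i\<in>F. c i * \<phi> i x)))\<^sup>2 =
      (L2_norm f)\<^sup>2 - (\<Sum>i\<in>F. (cmod (L2_inner f (\<phi> i)))\<^sup>2) + (\<Sum>i\<in>F. (cmod (c i - L2_inner f (\<phi> i)))\<^sup>2)"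
      using F by (intro L2_dist_orthonormal_combination f \<phi> on) auto
    moreover have "(\<Sum>i\<in>F. (cmod (c i - L2_inner f (\<phi> i)))\<^sup>2) \<ge> 0" by (simp add: sum_nonneg)
    ultimately have "(L2_norm f)\<^sup>2 \<le> (\<Sum>i\<in>F. (cmod (L2_inner f (\<phi> i)))\<^sup>2) + e"
      using \<open>e > 0\<close> by simp
    then have "ennreal ((L2_norm f)\<^sup>2) \<le> ennreal (\<Sum>i\<in>F. (cmod (L2_inner f (\<phi> i)))\<^sup>2) + ennreal e"
      using \<open>e > 0\<close> by (simp add: sum_nonneg flip: ennreal_plus)
    also have "ennreal (\<Sum>i\<in>F. (cmod (L2_inner f (\<phi> i)))\<^sup>2) =
        (\<integral>\<^sup>+i. ennreal ((cmod (L2_inner f (\<phi> i)))\<^sup>2) \<partial>count_space F)"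
      using F by (simp add: nn_integral_count_space_finite sum_ennreal)
    also have "\<dots> \<le> ?S"
      using F by (subst (1 2) nn_integral_count_space_indicator)
        (auto intro!: nn_integral_mono split: split_indicator)
    finally show "ennreal ((L2_norm f)\<^sup>2) \<le> ?S + ennreal e" by simp
  qed
qed

section \<open>Translations are continuous in \<open>L\<^sup>2\<close>\<close>

lemma lebesgue_distr_translation:
  fixes a :: "'a :: euclidean_space"
  shows "(\<lambda>x. x + a) \<in> lebesgue \<rightarrow>\<^sub>M lebesgue" "distr lebesgue lebesgue (\<lambda>x. x + a) = lebesgue"
proof -
  have e: "(\<lambda>x. a + (\<Sum>j\<in>Basis. (1 * (x \<bullet> j)) *\<^sub>R j)) = (\<lambda>x. x + a)"
    by (simp add: euclidean_representation add.commute)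
  show "(\<lambda>x. x + a) \<in> lebesgue \<rightarrow>\<^sub>M lebesgue"
    using lebesgue_affine_measurable[where c = "\<lambda>_::'a. 1" and t = a] by (simp only: e)
  have "lebesgue = density (distr lebesgue lebesgue (\<lambda>x. x + a)) (\<lambda>_. (\<Prod>j\<in>(Basis::'a set). \<bar>1::real\<bar>))"
    using lebesgue_affine_euclidean[where c = "\<lambda>_::'a. 1" and t = a] by (simp only: e)
  then show "distr lebesgue lebesgue (\<lambda>x. x + a) = lebesgue"
    by (simp add: density_1)
qed

lemma borel_measurable_lebesgue_translation:
  fixes f :: "'a :: euclidean_space \<Rightarrow> 'b :: topological_space"
  shows "f \<in> borel_measurable lebesgue \<Longrightarrow> (\<lambda>x. f (x + a)) \<in> borel_measurable lebesgue"
  using measurable_comp[OF lebesgue_distr_translation(1)[of a], of f borel] by (simp add: comp_def)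

lemma lebesgue_integral_translation:
  fixes f :: "'a :: euclidean_space \<Rightarrow> 'b :: {banach, second_countable_topology}"
  assumes "f \<in> borel_measurable lebesgue"
  shows "(\<integral>x. f (x + a) \<partial>lebesgue) = (\<integral>x. f x \<partial>lebesgue)"
  using integral_distr[OF lebesgue_distr_translation(1)[of a] assms]
  by (simp add: lebesgue_distr_translation(2))

lemma lebesgue_integrable_translation:
  fixes f :: "'a :: euclidean_space \<Rightarrow> 'b :: {banach, second_countable_topology}"
  assumes "integrable lebesgue f"
  shows "integrable lebesgue (\<lambda>x. f (x + a))"
  using integrable_distr[OF lebesgue_distr_translation(1)[of a], of f] assms
  by (simp add: lebesgue_distr_translation(2))

lemma L2_translate:
  assumes "f \<in> L2_space"
  shows "(\<lambda>x. f (x - a)) \<in> L2_space"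
  using assms borel_measurable_lebesgue_translation[of f "-a"]
    lebesgue_integrable_translation[of "\<lambda>x. (cmod (f x))\<^sup>2" "-a"]
  by (simp add: L2_space_def)

lemma L2_inner_translate:
  assumes "f \<in> L2_space" "h \<in> L2_space"
  shows "L2_inner (\<lambda>x. f (x - a)) (\<lambda>x. h (x - a)) = L2_inner f h"
  unfolding L2_inner_def
  using lebesgue_integral_translation[OF borel_measurable_integrable[OF L2_inner_integrable[OF assms]], of "-a"]
  by simp

lemma L2_norm_translate:
  assumes "f \<in> L2_space"
  shows "L2_norm (\<lambda>x. f (x - a)) = L2_norm f"
proof -
  have "(\<lambda>x. (cmod (f x))\<^sup>2) \<in> borel_measurable lebesgue"
    using assms by (auto simp: L2_space_def)
  from lebesgue_integral_translation[OF this, of "-a"] show ?thesis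
    by (simp add: L2_norm_def)
qed

lemma L2_tendsto_dominated:
  fixes s :: "nat \<Rightarrow> real ^ 'd \<Rightarrow> complex"
  assumes "\<And>n::nat. s n \<in> borel_measurable lebesgue"
    and "integrable lebesgue w"
    and "\<And>n. AE x in lebesgue. (cmod (s n x))\<^sup>2 \<le> w x"
    and "AE x in lebesgue. (\<lambda>n. s n x) \<longlonglongrightarrow> 0"
  shows "(\<lambda>n. L2_norm (s n)) \<longlonglongrightarrow> 0"
proof -
  have "(\<lambda>n. \<integral>x. (cmod (s n x))\<^sup>2 \<partial>lebesgue) \<longlonglongrightarrow> (\<integral>x. 0 \<partial>(lebesgue :: (real ^ 'd) measure))"
  proof (rule integral_dominated_convergence[where w = w])
    show "AE x in lebesgue. (\<lambda>n. (cmod (s n x))\<^sup>2) \<longlonglongrightarrow> 0"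
      using assms(4) by eventually_elim (auto intro!: tendsto_eq_intros simp: tendsto_norm_zero)
    show "(\<lambda>x. (cmod (s n x))\<^sup>2) \<in> borel_measurable lebesgue" for n
      using assms(1)[of n] by measurable
  qed (use assms in auto)
  then have "(\<lambda>n. sqrt (\<integral>x. (cmod (s n x))\<^sup>2 \<partial>lebesgue)) \<longlonglongrightarrow> sqrt 0"
    by (intro tendsto_real_sqrt) simp
  then show ?thesis by (simp add: L2_norm_def)
qed

lemma integrable_indicator_ball_lebesgue:
  "integrable lebesgue (\<lambda>x::'a::euclidean_space. c * indicator (cball 0 r) x :: real)"
  by (intro integrable_mult_right integrable_real_indicator) (use emeasure_lborel_cball_finite[of 0 r] in \<open>auto\<close>)

text \<open>Bounding both the argument and the value places the truncation in \<open>L\<^sup>1 \<inter> L\<^sup>2\<close>, as needed for an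
  approximating sequence in \<^const>\<open>is_fourier_L2\<close>.\<close>

definition truncate :: "real \<Rightarrow> ('a :: real_normed_vector \<Rightarrow> complex) \<Rightarrow> 'a \<Rightarrow> complex" where
  "truncate r f x = (if norm x \<le> r \<and> cmod (f x) \<le> r then f x else 0)"

lemma truncate_measurable:
  fixes f :: "'a :: euclidean_space \<Rightarrow> complex"
  assumes f: "f \<in> borel_measurable lebesgue"
  shows "truncate r f \<in> borel_measurable lebesgue"
proof -
  have "(norm :: 'a \<Rightarrow> real) \<in> borel_measurable lebesgue"
    by (intro measurable_completion) simp
  with f show ?thesis unfolding truncate_def[abs_def] by measurable
qed

lemma truncate_L2:
  assumes "f \<in> L2_space"
  shows "truncate r f \<in> L2_space"
proof -
  have m: "truncate r f \<in> borel_measurable lebesgue"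
    using assms by (intro truncate_measurable) (simp add: L2_space_def)
  have "integrable lebesgue (\<lambda>x. (cmod (truncate r f x))\<^sup>2)"
  proof (rule Bochner_Integration.integrable_bound)
    show "integrable lebesgue (\<lambda>x. (cmod (f x))\<^sup>2)"
      using assms by (simp add: L2_space_def)
    show "(\<lambda>x. (cmod (truncate r f x))\<^sup>2) \<in> borel_measurable lebesgue"
      using m by measurable
  qed (simp add: truncate_def)
  with m show ?thesis by (simp add: L2_space_def)
qed

lemma truncate_integrable:
  fixes f :: "'a :: euclidean_space \<Rightarrow> complex"
  assumes "f \<in> borel_measurable lebesgue"
  shows "integrable lebesgue (truncate r f)"
  by (rule Bochner_Integration.integrable_bound[OF integrable_indicator_ball_lebesgue[of r r]])
    (use assms in \<open>auto simp: truncate_measurable truncate_def split: split_indicator\<close>)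

lemma truncate_tendsto:
  assumes f: "f \<in> L2_space"
  shows "(\<lambda>n. L2_norm (\<lambda>x. truncate (real n) f x - f x)) \<longlonglongrightarrow> 0"
proof (rule L2_tendsto_dominated)
  show "integrable lebesgue (\<lambda>x. (cmod (f x))\<^sup>2)"
    using f by (simp add: L2_space_def)
  show "(\<lambda>x. truncate (real n) f x - f x) \<in> borel_measurable lebesgue" for n
    using f truncate_measurable[of f] by (auto simp: L2_space_def)
  show "AE x in lebesgue. (cmod (truncate (real n) f x - f x))\<^sup>2 \<le> (cmod (f x))\<^sup>2" for n
    by (auto simp: truncate_def)
  have "\<forall>\<^sub>F n in sequentially. truncate (real n) f x - f x = 0" for x
    using eventually_ge_at_top[of "nat \<lceil>max (norm x) (cmod (f x))\<rceil>"]
    by eventually_elim (auto simp: truncate_def nat_le_iff ceiling_le_iff)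
  then show "AE x in lebesgue. (\<lambda>n. truncate (real n) f x - f x) \<longlonglongrightarrow> 0"
    by (intro AE_I2 tendsto_eventually)
qed

text \<open>A truncation of \<open>f\<close> is close to \<open>f\<close> and, like every measurable function, the almost everywhere
  limit of continuous functions. Clamping the values of these functions and cutting them off
  outside of a ball keeps them continuous and makes the convergence dominated, hence \<open>L\<^sup>2\<close>
  convergence.\<close>

lemma L2_dense_continuous:
  fixes f :: "real ^ 'd \<Rightarrow> complex"
  assumes f: "f \<in> L2_space" and "e > 0"
  obtains d r where "continuous_on UNIV d" "\<And>x. norm x > r \<Longrightarrow> d x = 0" "\<And>x. cmod (d x) \<le> r"
    "d \<in> L2_space" "L2_norm (\<lambda>x. f x - d x) < e"
proof -
  from truncate_tendsto[OF f] \<open>e > 0\<close>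
  have "\<forall>\<^sub>F n in sequentially. L2_norm (\<lambda>x. truncate (real n) f x - f x) < e / 2"
    by (intro order_tendstoD) auto
  then obtain n where n: "L2_norm (\<lambda>x. truncate (real n) f x - f x) < e / 2" "n \<ge> 1"
    by (metis (mono_tags, lifting) eventually_sequentially le_cases order_trans)
  define k where "k = truncate (real n) f"
  have k2: "k \<in> L2_space" unfolding k_def by (rule truncate_L2[OF f])
  have k: "cmod (k x) \<le> real n" "norm x > real n \<Longrightarrow> k x = 0" for x
    by (auto simp: k_def truncate_def)
  have "k measurable_on UNIV"
    using k2 by (intro lebesgue_measurable_imp_measurable_on) (auto simp: L2_space_def)
  then obtain N c where N: "negligible N" and c: "\<And>j. continuous_on UNIV (c j)"
    and lim: "\<And>x. x \<notin> N \<Longrightarrow> (\<lambda>j. c j x) \<longlonglongrightarrow> k x"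
    unfolding measurable_on_def by (auto)
  define \<eta> where "\<eta> x = max 0 (min 1 (real n + 1 - norm x))" for x :: "real ^ 'd"
  define d where "d j x = complex_of_real (\<eta> x / max 1 (cmod (c j x) / real n)) * c j x" for j x
  have contd: "continuous_on UNIV (d j)" for j
    unfolding d_def \<eta>_def
    using c[of j] \<open>n \<ge> 1\<close> by (intro continuous_intros) auto
  have dm: "d j \<in> borel_measurable lebesgue" for j
    using borel_measurable_continuous_onI[OF contd[of j]] by (simp add: measurable_completion)
  have \<eta>: "0 \<le> \<eta> x" "\<eta> x \<le> 1" for x by (auto simp: \<eta>_def)
  have d_le: "cmod (d j x) \<le> real n" for j x
  proof -
    have "cmod (d j x) = \<eta> x * (cmod (c j x) / max 1 (cmod (c j x) / real n))"
      using \<eta>[of x] by (simp add: d_def norm_mult norm_divide)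
    also have "\<dots> \<le> 1 * real n"
    proof (rule mult_mono)
      show "cmod (c j x) / max 1 (cmod (c j x) / real n) \<le> real n"
        using \<open>n \<ge> 1\<close> by (simp add: divide_simps max_def)
    qed (use \<eta> in \<open>auto simp: max_def\<close>)
    finally show ?thesis by simp
  qed
  have d_out: "d j x = 0" if "norm x > real n + 1" for j x
    using that by (simp add: d_def \<eta>_def)
  have d_lim: "(\<lambda>j. d j x) \<longlonglongrightarrow> k x" if "x \<notin> N" for x
  proof -
    have "(\<lambda>j. d j x) \<longlonglongrightarrow> complex_of_real (\<eta> x / max 1 (cmod (k x) / real n)) * k x"
      unfolding d_def using lim[OF that] \<open>n \<ge> 1\<close> by (intro tendsto_intros) auto
    also have "complex_of_real (\<eta> x / max 1 (cmod (k x) / real n)) * k x = k x"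
      using k[of x] \<open>n \<ge> 1\<close> by (cases "norm x > real n") (auto simp: \<eta>_def max_def divide_simps)
    finally show ?thesis .
  qed
  have sq: "(cmod a)\<^sup>2 \<le> (2 * real n)\<^sup>2" if "cmod a \<le> 2 * real n" for a
    using that by (intro power_mono) auto
  have d2: "d j \<in> L2_space" for j
  proof -
    have "integrable lebesgue (\<lambda>x. (cmod (d j x))\<^sup>2)"
      using dm[of j] d_le[of j] d_out[where j = j] power_mono[OF d_le[of j] norm_ge_zero, of _ 2]
      by (intro Bochner_Integration.integrable_bound[OF integrable_indicator_ball_lebesgue[of "(real n)\<^sup>2" "real n + 1"]])
        (force split: split_indicator)+
    with dm show ?thesis by (simp add: L2_space_def)
  qed
  have "(\<lambda>j. L2_norm (\<lambda>x. d j x - k x)) \<longlonglongrightarrow> 0"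
  proof (rule L2_tendsto_dominated[OF _ integrable_indicator_ball_lebesgue[of "(2 * real n)\<^sup>2" "real n + 1"]])
    show "(\<lambda>x. d j x - k x) \<in> borel_measurable lebesgue" for j
      using dm[of j] k2 by (auto simp: L2_space_def)
    have "cmod (d j x - k x) \<le> 2 * real n" for j x
      using norm_triangle_ineq4[of "d j x" "k x"] d_le[of j x] k(1)[of x] by linarith
    moreover have "d j x - k x = 0" if "norm x > real n + 1" for j x
      using d_out[OF that] k(2)[of x] that by simp
    ultimately show "AE x in lebesgue. (cmod (d j x - k x))\<^sup>2 \<le> (2 * real n)\<^sup>2 * indicator (cball 0 (real n + 1)) x" for j
      using sq by (auto split: split_indicator simp: not_le)
    have "AE x in lebesgue. x \<notin> N"
      using N by (intro AE_not_in) (simp add: negligible_iff_null_sets)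
    then show "AE x in lebesgue. (\<lambda>j. d j x - k x) \<longlonglongrightarrow> 0"
      by eventually_elim (simp add: LIM_zero d_lim)
  qed
  then have "\<forall>\<^sub>F j in sequentially. L2_norm (\<lambda>x. d j x - k x) < e / 2"
    using \<open>e > 0\<close> by (intro order_tendstoD) auto
  then obtain j where j: "L2_norm (\<lambda>x. d j x - k x) < e / 2"
    by (auto simp: eventually_sequentially)
  have "L2_norm (\<lambda>x. f x - d j x) \<le> L2_norm (\<lambda>x. f x - k x) + L2_norm (\<lambda>x. k x - d j x)"
    by (rule L2_dist_triangle[OF f d2 k2])
  also have "\<dots> < e"
    using n(1) j L2_norm_minus_commute[of f k] L2_norm_minus_commute[of k "d j"] by (simp add: k_def)
  finally show ?thesis
    using that[of "d j" "real n + 1"] contd d_out d_le[of j] d2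
    by (metis add_increasing2 zero_le_one)
qed

text \<open>For a continuous function of bounded support this is dominated convergence; the general case
  follows by density, because translations are isometries.\<close>

lemma L2_translation_tendsto:
  assumes f: "f \<in> L2_space" and u: "u \<longlonglongrightarrow> 0"
  shows "(\<lambda>n. L2_norm (\<lambda>x. f (x - u n) - f x)) \<longlonglongrightarrow> 0"
proof (rule LIMSEQ_I)
  fix e :: real assume "e > 0"
  then have "e / 3 > 0" by simp
  then obtain d r where d: "continuous_on UNIV d" "\<And>x. norm x > r \<Longrightarrow> d x = 0" "\<And>x. cmod (d x) \<le> r"
    "d \<in> L2_space" "L2_norm (\<lambda>x. f x - d x) < e / 3"
    using L2_dense_continuous[OF f \<open>e / 3 > 0\<close>] by blast
  have "Bseq u" using u by (simp add: convergent_imp_Bseq convergentI)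
  then obtain B where B: "\<And>n. norm (u n) \<le> B" unfolding Bseq_def by blast
  have dcont: "isCont d x" for x
    using d(1) by (simp add: continuous_on_eq_continuous_at)
  have "(\<lambda>n. L2_norm (\<lambda>x. d (x - u n) - d x)) \<longlonglongrightarrow> 0"
  proof (rule L2_tendsto_dominated[OF _ integrable_indicator_ball_lebesgue[of "(2 * r)\<^sup>2" "r + B"]])
    show "(\<lambda>x. d (x - u n) - d x) \<in> borel_measurable lebesgue" for n
      using L2_diff[OF L2_translate[OF d(4)] d(4)] by (auto simp: L2_space_def)
    have *: "cmod (d (x - u n) - d x) \<le> 2 * r" for n x
      using norm_triangle_ineq4[of "d (x - u n)" "d x"] d(3)[of "x - u n"] d(3)[of x] by linarith
    have "d (x - u n) - d x = 0" if "norm x > r + B" for n x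
    proof -
      have "norm (x - u n) > r" "norm x > r"
        using that norm_triangle_ineq2[of x "u n"] B[of n] norm_ge_zero[of "u n"] by linarith+
      then show ?thesis by (simp add: d)
    qed
    moreover have "(cmod (d (x - u n) - d x))\<^sup>2 \<le> (2 * r)\<^sup>2" for n x
      by (intro power_mono * norm_ge_zero)
    ultimately show "AE x in lebesgue. (cmod (d (x - u n) - d x))\<^sup>2 \<le> (2 * r)\<^sup>2 * indicator (cball 0 (r + B)) x" for n
      by (auto split: split_indicator simp: not_le)
    have "(\<lambda>n. d (x - u n)) \<longlonglongrightarrow> d (x - 0)" for x
      using dcont u by (intro isCont_tendsto_compose[of _ d] tendsto_intros) auto
    then show "AE x in lebesgue. (\<lambda>n. d (x - u n) - d x) \<longlonglongrightarrow> 0"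
      by (auto simp: LIM_zero)
  qed
  from LIMSEQ_D[OF this \<open>e / 3 > 0\<close>]
  obtain no where no: "\<And>n. n \<ge> no \<Longrightarrow> L2_norm (\<lambda>x. d (x - u n) - d x) < e / 3"
    by auto
  have "L2_norm (\<lambda>x. f (x - u n) - f x) < e" if "n \<ge> no" for n
  proof -
    have "L2_norm (\<lambda>x. f (x - u n) - f x) \<le>
        L2_norm (\<lambda>x. f (x - u n) - d (x - u n)) + L2_norm (\<lambda>x. d (x - u n) - f x)"
      by (intro L2_dist_triangle L2_translate f d)
    also have "L2_norm (\<lambda>x. d (x - u n) - f x) \<le>
        L2_norm (\<lambda>x. d (x - u n) - d x) + L2_norm (\<lambda>x. d x - f x)"
      by (intro L2_dist_triangle L2_translate f d)
    also have "L2_norm (\<lambda>x. f (x - u n) - d (x - u n)) = L2_norm (\<lambda>x. f x - d x)"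
      by (rule L2_norm_translate[OF L2_diff[OF f d(4)]])
    finally show ?thesis
      using d(5) no[OF that] L2_norm_minus_commute[of f d] by simp
  qed
  then show "\<exists>no. \<forall>n\<ge>no. norm (L2_norm (\<lambda>x. f (x - u n) - f x) - 0) < e" by auto
qed

section \<open>Gaussians\<close>

text \<open>The density of the standard normal distribution on the whole space. The product form reduces its
  Fourier transform to the characteristic function of the one-dimensional distribution.\<close>

definition gauss :: "'a :: euclidean_space \<Rightarrow> real" where
  "gauss w = (\<Prod>b\<in>Basis. std_normal_density (w \<bullet> b))"

lemma gauss_nonneg: "gauss w \<ge> 0"
  unfolding gauss_def by (intro prod_nonneg) auto

lemma gauss_measurable [measurable]: "gauss \<in> borel_measurable borel"
  unfolding gauss_def[abs_def] by measurable

lemma norm_power2_eq_sum: "(norm w)\<^sup>2 = (\<Sum>b\<in>Basis. (w \<bullet> b)\<^sup>2)"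
  by (subst power2_norm_eq_inner, subst euclidean_inner) (simp add: power2_eq_square)

text \<open>Together with \<open>gauss_fourier\<close> this says that \<^const>\<open>gauss\<close> is its own Fourier transform up to a constant
  factor.\<close>

lemma gauss_eq:
  fixes w :: "'a :: euclidean_space"
  shows "exp (- (norm w)\<^sup>2 / 2) = sqrt (2 * pi) ^ DIM('a) * gauss w"
proof -
  have "exp (- (norm w)\<^sup>2 / 2) = (\<Prod>b\<in>Basis. exp (- (w \<bullet> b)\<^sup>2 / 2))"
    by (simp add: norm_power2_eq_sum exp_sum[symmetric] sum_divide_distrib sum_negf)
  also have "\<dots> = (\<Prod>b\<in>Basis. sqrt (2 * pi) * std_normal_density (w \<bullet> b))"
    by (intro prod.cong) (auto simp: std_normal_density_def)
  finally show ?thesis by (simp add: gauss_def prod.distrib)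
qed

lemma lborel_integral_prod:
  fixes f :: "'a::euclidean_space \<Rightarrow> real \<Rightarrow> complex"
  assumes "\<And>b. b \<in> Basis \<Longrightarrow> integrable lborel (f b)"
  shows "integrable lborel (\<lambda>w::'a. \<Prod>b\<in>Basis. f b (w \<bullet> b))"
    "(\<integral>w. (\<Prod>b\<in>Basis. f b (w \<bullet> b)) \<partial>(lborel :: 'a measure)) = (\<Prod>b\<in>Basis. \<integral>x. f b x \<partial>lborel)"
proof -
  interpret product_sigma_finite "\<lambda>b::'a. lborel :: real measure" ..
  have [measurable]: "f b \<in> borel_measurable borel" if "b \<in> Basis" for b
    using assms[OF that] by (simp add: borel_measurable_integrable flip: measurable_lborel1)
  let ?T = "\<lambda>g::'a \<Rightarrow> real. \<Sum>b\<in>Basis. g b *\<^sub>R b"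
  have T: "?T \<in> (\<Pi>\<^sub>M b\<in>Basis. lborel) \<rightarrow>\<^sub>M borel" by measurable
  have m: "(\<lambda>w::'a. \<Prod>b\<in>Basis. f b (w \<bullet> b)) \<in> borel_measurable borel" by measurable
  have e: "(\<Prod>b\<in>Basis. f b (?T g \<bullet> b)) = (\<Prod>b\<in>Basis. f b (g b))" for g
    by (intro prod.cong) auto
  have i: "integrable (\<Pi>\<^sub>M b\<in>Basis. lborel) (\<lambda>g. \<Prod>b\<in>Basis. f b (g b))"
    by (rule product_integrable_prod) (use assms in auto)
  show "integrable lborel (\<lambda>w::'a. \<Prod>b\<in>Basis. f b (w \<bullet> b))"
    by (subst lborel_eq, subst integrable_distr_eq[OF T m]) (simp only: e i)
  have "(\<integral>w. (\<Prod>b\<in>Basis. f b (w \<bullet> b)) \<partial>(lborel :: 'a measure)) =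
      (\<integral>g. (\<Prod>b\<in>Basis. f b (g b)) \<partial>(\<Pi>\<^sub>M b\<in>Basis. lborel))"
    by (subst lborel_eq, subst integral_distr[OF T m]) (simp only: e)
  also have "\<dots> = (\<Prod>b\<in>Basis. \<integral>x. f b x \<partial>lborel)"
    by (rule product_integral_prod) (use assms in auto)
  finally show "(\<integral>w. (\<Prod>b\<in>Basis. f b (w \<bullet> b)) \<partial>(lborel :: 'a measure)) = (\<Prod>b\<in>Basis. \<integral>x. f b x \<partial>lborel)" .
qed

lemma cis_measurable [measurable]: "cis \<in> borel_measurable borel"
  by (intro borel_measurable_continuous_onI continuous_intros)

lemma std_normal_fourier:
  "integrable lborel (\<lambda>x. complex_of_real (std_normal_density x) * cis (t * x))"
  "(\<integral>x. complex_of_real (std_normal_density x) * cis (t * x) \<partial>lborel) = complex_of_real (exp (- t\<^sup>2 / 2))"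
proof -
  show "integrable lborel (\<lambda>x. complex_of_real (std_normal_density x) * cis (t * x))"
    by (rule Bochner_Integration.integrable_bound[of _ std_normal_density])
      (auto simp: norm_mult integrable_normal_density)
  have "char std_normal_distribution t = (\<integral>x. std_normal_density x *\<^sub>R cis (t * x) \<partial>lborel)"
    unfolding char_def cis_conv_exp by (subst integral_density) auto
  then show "(\<integral>x. complex_of_real (std_normal_density x) * cis (t * x) \<partial>lborel) = complex_of_real (exp (- t\<^sup>2 / 2))"
    by (simp add: char_std_normal_distribution scaleR_conv_of_real)
qed

lemma cis_sum: "finite B \<Longrightarrow> cis (\<Sum>b\<in>B. f b) = (\<Prod>b\<in>B. cis (f b))"
  by (induction B rule: finite_induct) (auto simp: cis_mult[symmetric])

lemma gauss_fourier:
  fixes t :: "'a :: euclidean_space"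
  shows "integrable lborel (\<lambda>w::'a. complex_of_real (gauss w) * cis (t \<bullet> w))"
    and "(\<integral>w. complex_of_real (gauss w) * cis (t \<bullet> w) \<partial>lborel) = complex_of_real (exp (- (norm t)\<^sup>2 / 2))"
proof -
  have e: "complex_of_real (gauss w) * cis (t \<bullet> w) =
      (\<Prod>b\<in>Basis. complex_of_real (std_normal_density (w \<bullet> b)) * cis ((t \<bullet> b) * (w \<bullet> b)))" for w
    unfolding euclidean_inner[of t w] by (simp add: gauss_def cis_sum prod.distrib)
  show "integrable lborel (\<lambda>w::'a. complex_of_real (gauss w) * cis (t \<bullet> w))"
    unfolding e by (rule lborel_integral_prod(1)) (rule std_normal_fourier)
  have "(\<integral>w. complex_of_real (gauss w) * cis (t \<bullet> w) \<partial>lborel) =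
      (\<Prod>b\<in>Basis. complex_of_real (exp (- (t \<bullet> b)\<^sup>2 / 2)))"
    unfolding e by (subst lborel_integral_prod(2)) (simp_all add: std_normal_fourier)
  also have "\<dots> = complex_of_real (exp (\<Sum>b\<in>Basis. - (t \<bullet> b)\<^sup>2 / 2))"
    by (simp only: of_real_prod exp_sum[OF finite_Basis])
  also have "(\<Sum>b\<in>Basis. - (t \<bullet> b)\<^sup>2 / 2) = - (norm t)\<^sup>2 / 2"
    by (simp add: norm_power2_eq_sum sum_divide_distrib sum_negf)
  finally show "(\<integral>w. complex_of_real (gauss w) * cis (t \<bullet> w) \<partial>lborel) = complex_of_real (exp (- (norm t)\<^sup>2 / 2))" .
qed

lemma gauss_integrable: "integrable lborel (gauss :: 'a :: euclidean_space \<Rightarrow> real)"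
  and gauss_integral: "(\<integral>w. gauss (w :: 'a) \<partial>lborel) = 1"
proof -
  have i: "integrable lborel (\<lambda>w::'a. complex_of_real (gauss w))"
    using gauss_fourier(1)[of "0::'a"] by simp
  then show "integrable lborel (gauss :: 'a \<Rightarrow> real)"
    by (simp only: complex_of_real_integrable_eq)
  have "complex_of_real (\<integral>w. gauss (w :: 'a) \<partial>lborel) = 1"
    using gauss_fourier(2)[of "0::'a"] by (simp add: integral_complex_of_real)
  then show "(\<integral>w. gauss (w :: 'a) \<partial>lborel) = 1" by simp
qed

lemma lborel_integral_scale:
  fixes f :: "'a :: euclidean_space \<Rightarrow> 'b :: {banach, second_countable_topology}"
  assumes "c \<noteq> 0" and f [measurable]: "f \<in> borel_measurable borel"
  shows "(\<integral>x. f x \<partial>lborel) = \<bar>c\<bar> ^ DIM('a) *\<^sub>R (\<integral>x. f (a + c *\<^sub>R x) \<partial>lborel)"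
  by (subst lborel_affine[OF \<open>c \<noteq> 0\<close>, of a], subst integral_density)
    (auto simp: integral_distr)

lemma lborel_integrable_scale:
  fixes f :: "'a :: euclidean_space \<Rightarrow> 'b :: {banach, second_countable_topology}"
  assumes "c \<noteq> 0" and f: "integrable lborel f"
  shows "integrable lborel (\<lambda>x. f (a + c *\<^sub>R x))"
proof -
  have [measurable]: "f \<in> borel_measurable borel" using f by (simp add: borel_measurable_integrable flip: measurable_lborel1)
  have "integrable lborel (\<lambda>x. \<bar>c\<bar> ^ DIM('a) *\<^sub>R f (a + c *\<^sub>R x))"
    using f by (subst (asm) lborel_affine[OF \<open>c \<noteq> 0\<close>, of a], subst (asm) integrable_density)
      (auto simp: integrable_distr_eq)
  from integrable_scaleR_right[OF this, of "inverse (\<bar>c\<bar> ^ DIM('a))"] show ?thesis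
    using \<open>c \<noteq> 0\<close> by simp
qed

lemma gaussian_integrable:
  assumes "\<sigma> \<noteq> 0"
  shows "integrable lborel (\<lambda>\<xi>::'a::euclidean_space. exp (- (norm (\<sigma> *\<^sub>R \<xi>))\<^sup>2 / 2))"
  unfolding gauss_eq using lborel_integrable_scale[OF assms gauss_integrable, of 0]
  by (intro integrable_mult_right) simp

section \<open>Plancherel's theorem\<close>

abbreviation char_fun :: "real \<Rightarrow> complex" where
  "char_fun x \<equiv> cis (2 * pi * x)"

lemma fourier_L1_eq: "fourier_L1 f \<xi> = (\<integral>x. f x * char_fun (- (\<xi> \<bullet> x)) \<partial>lebesgue)"
  unfolding fourier_L1_def by (simp add: cis_conv_exp mult_ac)

lemma fourier_L1_borel:
  assumes "f \<in> borel_measurable borel"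
  shows "fourier_L1 f \<xi> = (\<integral>x. f x * char_fun (- (\<xi> \<bullet> x)) \<partial>lborel)"
  unfolding fourier_L1_eq by (rule integral_completion) (use assms in measurable)

lemma fourier_L1_measurable:
  assumes [measurable]: "f \<in> borel_measurable borel"
  shows "fourier_L1 f \<in> borel_measurable borel"
  unfolding fourier_L1_borel[OF assms, abs_def] by measurable

lemma integrable_mult_cis:
  fixes f :: "'a :: euclidean_space \<Rightarrow> complex"
  assumes "integrable lborel f" "h \<in> borel_measurable borel"
  shows "integrable lborel (\<lambda>x. f x * cis (h x))"
  by (rule Bochner_Integration.integrable_bound[OF assms(1)])
    (use assms in \<open>auto simp: norm_mult\<close>)

text \<open>The Fourier transform may be moved from \<open>A\<close> to the Gaussian weight by Fubini's theorem. It turns the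
  weight into a multiple of a narrow Gaussian; the substitution \<open>v = (\<sigma> / (2 * pi)) w\<close> then makes the
  weight independent of \<open>\<sigma>\<close> and absorbs the constant. As \<open>\<sigma>\<close> tends to 0, the left side recovers the
  integral of a nonnegative transform and the right side tends to \<open>A 0\<close> when \<open>A\<close> is bounded and continuous at
  0.\<close>

lemma gauss_weighted_fourier:
  fixes A :: "real ^ 'd \<Rightarrow> complex"
  assumes A: "integrable lborel A" and "\<sigma> > 0"
  shows "(\<integral>\<xi>. exp (- (norm (\<sigma> *\<^sub>R \<xi>))\<^sup>2 / 2) * fourier_L1 A \<xi> \<partial>lborel) =
    (\<integral>w. gauss w * A ((\<sigma> / (2 * pi)) *\<^sub>R w) \<partial>lborel)"
proof -
  let ?d = "DIM(real ^ 'd)"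
  let ?s = "\<sigma> / (2 * pi)"
  let ?K = "sqrt (2 * pi) ^ ?d"
  let ?\<gamma> = "\<lambda>\<xi>::real^'d. complex_of_real (exp (- (norm (\<sigma> *\<^sub>R \<xi>))\<^sup>2 / 2))"
  have s: "?s > 0" "?s \<noteq> 0" using \<open>\<sigma> > 0\<close> by auto
  have [measurable]: "A \<in> borel_measurable borel"
    using A by (simp add: borel_measurable_integrable flip: measurable_lborel1)
  have \<gamma>_gauss: "?\<gamma> \<xi> = complex_of_real (?K * gauss (\<sigma> *\<^sub>R \<xi>))" for \<xi>
    by (simp only: gauss_eq)
  have \<gamma>_int: "integrable lborel ?\<gamma>"
    using gaussian_integrable[of \<sigma>] \<open>\<sigma> > 0\<close> by (intro integrable_of_real) simp
  have A_scaled: "fourier_L1 A \<xi> = ?s ^ ?d *\<^sub>R (\<integral>w. A (?s *\<^sub>R w) * cis (- (\<sigma> * (\<xi> \<bullet> w))) \<partial>lborel)" for \<xi>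
    by (subst fourier_L1_borel, measurable, subst lborel_integral_scale[OF s(2), where a = 0])
      (use \<open>\<sigma> > 0\<close> in auto)
  have inner: "(\<integral>\<xi>. ?\<gamma> \<xi> * cis (- (\<sigma> * (\<xi> \<bullet> w))) \<partial>lborel) =
      complex_of_real ((1 / \<sigma>) ^ ?d * ?K ^ 2 * gauss w)" for w
  proof -
    let ?h = "\<lambda>\<eta>::real^'d. complex_of_real ?K * (complex_of_real (gauss \<eta>) * cis ((- w) \<bullet> \<eta>))"
    have "(\<integral>\<eta>. ?h \<eta> \<partial>lborel) = \<bar>\<sigma>\<bar> ^ ?d *\<^sub>R (\<integral>\<xi>. ?h (0 + \<sigma> *\<^sub>R \<xi>) \<partial>lborel)"
      using \<open>\<sigma> > 0\<close> by (intro lborel_integral_scale) auto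
    also have "(\<lambda>\<xi>. ?h (0 + \<sigma> *\<^sub>R \<xi>)) = (\<lambda>\<xi>. ?\<gamma> \<xi> * cis (- (\<sigma> * (\<xi> \<bullet> w))))"
      unfolding \<gamma>_gauss by (simp add: inner_commute mult_ac)
    finally have "\<sigma> ^ ?d *\<^sub>R (\<integral>\<xi>. ?\<gamma> \<xi> * cis (- (\<sigma> * (\<xi> \<bullet> w))) \<partial>lborel) = (\<integral>\<eta>. ?h \<eta> \<partial>lborel)"
      using \<open>\<sigma> > 0\<close> by simp
    also have "\<dots> = complex_of_real (?K * exp (- (norm w)\<^sup>2 / 2))"
      by (subst integral_mult_right_zero, subst gauss_fourier(2)) simp
    also have "\<dots> = complex_of_real (?K ^ 2 * gauss w)"
      by (simp only: gauss_eq) (simp add: power2_eq_square)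
    finally have "(1 / \<sigma>) ^ ?d *\<^sub>R \<sigma> ^ ?d *\<^sub>R (\<integral>\<xi>. ?\<gamma> \<xi> * cis (- (\<sigma> * (\<xi> \<bullet> w))) \<partial>lborel) =
      (1 / \<sigma>) ^ ?d *\<^sub>R complex_of_real (?K ^ 2 * gauss w)" by simp
    moreover have "(1 / \<sigma>) ^ ?d * \<sigma> ^ ?d = 1"
      using \<open>\<sigma> > 0\<close> by (simp flip: power_mult_distrib)
    ultimately show ?thesis
      by (simp only: scaleR_scaleR scaleR_one) (simp add: scaleR_conv_of_real)
  qed
  have const: "?s ^ ?d * ((1 / \<sigma>) ^ ?d * ?K ^ 2) = 1"
  proof -
    have "?K ^ 2 = (2 * pi) ^ ?d"
      using power_mult[of "sqrt (2 * pi)" ?d 2] power_mult[of "sqrt (2 * pi)" 2 ?d]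
      by (simp add: mult.commute)
    then have "?s ^ ?d * ((1 / \<sigma>) ^ ?d * ?K ^ 2) = (?s * (1 / \<sigma>) * (2 * pi)) ^ ?d"
      by (simp only: power_mult_distrib mult.assoc)
    also have "?s * (1 / \<sigma>) * (2 * pi) = 1" using \<open>\<sigma> > 0\<close> by simp
    finally show ?thesis by simp
  qed
  have As: "integrable lborel (\<lambda>w. A (?s *\<^sub>R w))"
    using lborel_integrable_scale[OF s(2) A, of 0] by simp
  let ?F = "\<lambda>\<xi> w. ?\<gamma> \<xi> * (A (?s *\<^sub>R w) * cis (- (\<sigma> * (\<xi> \<bullet> w))))"
  have F: "integrable (lborel \<Otimes>\<^sub>M lborel) (case_prod ?F)"
  proof (rule lborel_pair.Fubini_integrable)
    show "case_prod ?F \<in> borel_measurable (lborel \<Otimes>\<^sub>M lborel)" by measurable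
    show "integrable lborel (\<lambda>\<xi>. \<integral>w. norm (case_prod ?F (\<xi>, w)) \<partial>lborel)"
      using integrable_norm[OF \<gamma>_int] by (simp add: norm_mult)
    show "AE \<xi> in lborel. integrable lborel (\<lambda>w. case_prod ?F (\<xi>, w))"
      using As by (auto intro!: integrable_mult_right integrable_mult_cis)
  qed
  have "(\<integral>\<xi>. ?\<gamma> \<xi> * fourier_L1 A \<xi> \<partial>lborel) = ?s ^ ?d *\<^sub>R (\<integral>\<xi>. (\<integral>w. ?F \<xi> w \<partial>lborel) \<partial>lborel)"
    unfolding A_scaled by simp
  also have "(\<integral>\<xi>. (\<integral>w. ?F \<xi> w \<partial>lborel) \<partial>lborel) = (\<integral>w. (\<integral>\<xi>. ?F \<xi> w \<partial>lborel) \<partial>lborel)"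
    by (rule lborel_pair.Fubini_integral[OF F, symmetric])
  also have "\<dots> = (\<integral>w. A (?s *\<^sub>R w) * (\<integral>\<xi>. ?\<gamma> \<xi> * cis (- (\<sigma> * (\<xi> \<bullet> w))) \<partial>lborel) \<partial>lborel)"
    by (simp only: mult.left_commute[of "?\<gamma> _"] integral_mult_right_zero)
  also have "?s ^ ?d *\<^sub>R \<dots> = (\<integral>w. ?s ^ ?d *\<^sub>R (A (?s *\<^sub>R w) * (\<integral>\<xi>. ?\<gamma> \<xi> * cis (- (\<sigma> * (\<xi> \<bullet> w))) \<partial>lborel)) \<partial>lborel)"
    by (rule integral_scaleR_right[symmetric])
  also have "\<dots> = (\<integral>w. gauss w * A (?s *\<^sub>R w) \<partial>lborel)"
  proof (rule Bochner_Integration.integral_cong[OF refl])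
    fix w
    have "?s ^ ?d *\<^sub>R (A (?s *\<^sub>R w) * (\<integral>\<xi>. ?\<gamma> \<xi> * cis (- (\<sigma> * (\<xi> \<bullet> w))) \<partial>lborel)) =
       complex_of_real (?s ^ ?d * ((1 / \<sigma>) ^ ?d * ?K ^ 2)) * (gauss w * A (?s *\<^sub>R w))"
      unfolding inner by (simp add: scaleR_conv_of_real mult_ac)
    then show "?s ^ ?d *\<^sub>R (A (?s *\<^sub>R w) * (\<integral>\<xi>. ?\<gamma> \<xi> * cis (- (\<sigma> * (\<xi> \<bullet> w))) \<partial>lborel)) =
       gauss w * A (?s *\<^sub>R w)"
      unfolding const by simp
  qed
  finally show ?thesis .
qed

text \<open>\<open>A\<close> is the convolution of \<open>f\<close> with the conjugate of its reflection, and the transform of a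
  convolution is the product of the transforms.\<close>

lemma autocorrelation_fourier:
  fixes f :: "real ^ 'd \<Rightarrow> complex"
  assumes [measurable]: "f \<in> borel_measurable borel" and f: "integrable lborel f"
  defines "A \<equiv> \<lambda>v. \<integral>x. f x * cnj (f (x - v)) \<partial>lborel"
  shows "integrable lborel A" and "fourier_L1 A \<xi> = complex_of_real ((cmod (fourier_L1 f \<xi>))\<^sup>2)"
proof -
  have reflect: "(\<integral>v. k (x - v) \<partial>lborel) = (\<integral>v. k v \<partial>lborel)"
    if "k \<in> borel_measurable borel" for k :: "real ^ 'd \<Rightarrow> 'c :: {banach, second_countable_topology}" and x
    using lborel_integral_scale[of "-1" k x] that by simp
  have reflect_int: "integrable lborel (\<lambda>v. k (x - v))"
    if "integrable lborel k" for k :: "real ^ 'd \<Rightarrow> complex" and x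
    using lborel_integrable_scale[of "-1" k x] that by simp
  let ?G = "\<lambda>x v. f x * cnj (f (x - v))"
  have G: "integrable (lborel \<Otimes>\<^sub>M lborel) (case_prod ?G)"
  proof (rule lborel_pair.Fubini_integrable)
    show "case_prod ?G \<in> borel_measurable (lborel \<Otimes>\<^sub>M lborel)" by measurable
    have "(\<lambda>x. \<integral>v. norm (case_prod ?G (x, v)) \<partial>lborel) = (\<lambda>x. cmod (f x) * (\<integral>v. cmod (f v) \<partial>lborel))"
      using reflect[of "\<lambda>v. cmod (f v)"] by (simp add: norm_mult)
    then show "integrable lborel (\<lambda>x. \<integral>v. norm (case_prod ?G (x, v)) \<partial>lborel)"
      using integrable_norm[OF f] by simp
    show "AE x in lborel. integrable lborel (\<lambda>v. case_prod ?G (x, v))"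
      using reflect_int[OF f] by (auto intro!: integrable_mult_right)
  qed
  show "integrable lborel A"
    unfolding A_def by (rule lborel_pair.integrable_snd[OF G])
  have Am [measurable]: "A \<in> borel_measurable borel" unfolding A_def by measurable
  let ?H = "\<lambda>x v. ?G x v * char_fun (- (\<xi> \<bullet> v))"
  have H: "integrable (lborel \<Otimes>\<^sub>M lborel) (case_prod ?H)"
    by (rule Bochner_Integration.integrable_bound[OF G]) (auto simp: norm_mult)
  have inner: "(\<integral>v. ?H x v \<partial>lborel) = f x * char_fun (- (\<xi> \<bullet> x)) * cnj (fourier_L1 f \<xi>)" for x
  proof -
    have "(\<integral>v. ?H x v \<partial>lborel) = f x * (\<integral>v. cnj (f (x - v)) * char_fun (- (\<xi> \<bullet> (x - (x - v)))) \<partial>lborel)"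
      by (simp add: mult.assoc)
    also have "(\<integral>v. cnj (f (x - v)) * char_fun (- (\<xi> \<bullet> (x - (x - v)))) \<partial>lborel) =
        (\<integral>y. cnj (f y) * char_fun (- (\<xi> \<bullet> (x - y))) \<partial>lborel)"
      by (rule reflect) measurable
    also have "\<dots> = (\<integral>y. char_fun (- (\<xi> \<bullet> x)) * cnj (f y * char_fun (- (\<xi> \<bullet> y))) \<partial>lborel)"
    proof (intro Bochner_Integration.integral_cong refl)
      fix y
      have "char_fun (- (\<xi> \<bullet> (x - y))) = char_fun (- (\<xi> \<bullet> x)) * cnj (char_fun (- (\<xi> \<bullet> y)))"
        by (simp add: cis_cnj cis_mult inner_diff_right right_diff_distrib)
      then show "cnj (f y) * char_fun (- (\<xi> \<bullet> (x - y))) =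
          char_fun (- (\<xi> \<bullet> x)) * cnj (f y * char_fun (- (\<xi> \<bullet> y)))"
        by simp
    qed
    also have "\<dots> = char_fun (- (\<xi> \<bullet> x)) * cnj (fourier_L1 f \<xi>)"
      by (simp only: integral_mult_right_zero Bochner_Integration.integral_cnj fourier_L1_borel[OF assms(1)])
    finally show ?thesis by (simp add: mult.assoc)
  qed
  have "fourier_L1 A \<xi> = (\<integral>v. (\<integral>x. ?H x v \<partial>lborel) \<partial>lborel)"
    by (simp add: fourier_L1_borel[OF Am]) (simp add: A_def)
  also have "\<dots> = (\<integral>x. (\<integral>v. ?H x v \<partial>lborel) \<partial>lborel)"
    by (rule lborel_pair.Fubini_integral[OF H])
  also have "\<dots> = fourier_L1 f \<xi> * cnj (fourier_L1 f \<xi>)"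
    unfolding inner by (simp add: fourier_L1_borel[OF assms(1)])
  finally show "fourier_L1 A \<xi> = complex_of_real ((cmod (fourier_L1 f \<xi>))\<^sup>2)"
    by (simp only: complex_norm_square)
qed

text \<open>The autocorrelation \<open>A v = L2_inner f (\<lambda>x. f (x - v))\<close> is bounded by the Cauchy-Schwarz inequality,
  continuous at 0 by the continuity of translations, and \<open>A 0\<close> is the squared norm of \<open>f\<close>. With the
  transform of \<open>A\<close> being \<open>\<bar>fourier_L1 f\<bar>\<^sup>2 \<ge> 0\<close>, the limit of the Gaussian averages on its side exists
  by monotone convergence, so that square integrability is part of the conclusion.\<close>

lemma Plancherel_borel:
  fixes f :: "real ^ 'd \<Rightarrow> complex"
  assumes [measurable]: "f \<in> borel_measurable borel" and f: "integrable lborel f" and f2: "f \<in> L2_space"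
  shows "fourier_L1 f \<in> L2_space" "L2_norm (fourier_L1 f) = L2_norm f"
proof -
  define A where "A = (\<lambda>v. \<integral>x. f x * cnj (f (x - v)) \<partial>lborel)"
  have A: "A v = L2_inner f (\<lambda>x. f (x - v))" for v
    unfolding A_def L2_inner_def by (rule integral_completion[symmetric]) measurable
  note A_fourier = autocorrelation_fourier[OF assms(1) f, folded A_def]
  have Am [measurable]: "A \<in> borel_measurable borel" unfolding A_def by measurable
  have A_bound: "cmod (A v) \<le> (L2_norm f)\<^sup>2" for v
    using L2_Cauchy_Schwarz[OF f2 L2_translate[OF f2, of v]]
    by (simp add: A L2_norm_translate[OF f2] power2_eq_square)
  have A_lim: "(\<lambda>n. A (u n)) \<longlonglongrightarrow> complex_of_real ((L2_norm f)\<^sup>2)" if "u \<longlonglongrightarrow> 0" for u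
    unfolding A L2_inner_self[symmetric]
    by (intro L2_inner_tendsto f2 L2_translate L2_translation_tendsto that) (simp add: L2_norm_def)
  have Fm [measurable]: "fourier_L1 f \<in> borel_measurable borel"
    by (rule fourier_L1_measurable) measurable
  define \<sigma> where "\<sigma> n = inverse (real (Suc n))" for n
  have \<sigma>: "\<sigma> n > 0" for n by (simp add: \<sigma>_def)
  have \<sigma>_lim: "\<sigma> \<longlonglongrightarrow> 0" unfolding \<sigma>_def by (rule LIMSEQ_inverse_real_of_nat)
  define E where "E n \<xi> = exp (- (norm (\<sigma> n *\<^sub>R \<xi>))\<^sup>2 / 2) * (cmod (fourier_L1 f \<xi>))\<^sup>2" for n and \<xi> :: "real ^ 'd"
  have F_bound: "(cmod (fourier_L1 f \<xi>))\<^sup>2 \<le> (\<integral>x. cmod (f x) \<partial>lborel)\<^sup>2" for \<xi>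
    using integral_norm_bound[of lborel "\<lambda>x. f x * char_fun (- (\<xi> \<bullet> x))"]
    by (intro power_mono) (auto simp: fourier_L1_borel norm_mult)
  have E_int: "integrable lborel (E n)" for n
  proof (rule Bochner_Integration.integrable_bound)
    show "integrable lborel (\<lambda>\<xi>::real^'d. exp (- (norm (\<sigma> n *\<^sub>R \<xi>))\<^sup>2 / 2) * (\<integral>x. cmod (f x) \<partial>lborel)\<^sup>2)"
      using \<sigma>[of n] by (intro integrable_mult_left gaussian_integrable) auto
    show "E n \<in> borel_measurable lborel" unfolding E_def by measurable
    show "AE \<xi> in lborel. norm (E n \<xi>) \<le> norm (exp (- (norm (\<sigma> n *\<^sub>R \<xi>))\<^sup>2 / 2) * (\<integral>x. cmod (f x) \<partial>lborel)\<^sup>2)"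
      using F_bound by (auto simp: E_def abs_mult)
  qed
  have "complex_of_real (\<integral>\<xi>. E n \<xi> \<partial>lborel) = (\<integral>w. gauss w * A ((\<sigma> n / (2 * pi)) *\<^sub>R w) \<partial>lborel)" for n
    using gauss_weighted_fourier[OF A_fourier(1) \<sigma>[of n]]
    by (simp add: A_fourier(2) E_def flip: integral_complex_of_real)
  moreover have "(\<lambda>n. \<integral>w. gauss w * A ((\<sigma> n / (2 * pi)) *\<^sub>R w) \<partial>lborel) \<longlonglongrightarrow>
      (\<integral>w. gauss (w :: real ^ 'd) * complex_of_real ((L2_norm f)\<^sup>2) \<partial>lborel)"
  proof (rule integral_dominated_convergence)
    show "integrable lborel (\<lambda>w::real^'d. gauss w * (L2_norm f)\<^sup>2)"
      by (intro integrable_mult_left gauss_integrable)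
    show "AE w in lborel. norm (complex_of_real (gauss w) * A ((\<sigma> n / (2 * pi)) *\<^sub>R w)) \<le> gauss w * (L2_norm f)\<^sup>2" for n
      using A_bound by (auto simp: norm_mult gauss_nonneg intro!: mult_left_mono)
    have "(\<lambda>n. A ((\<sigma> n / (2 * pi)) *\<^sub>R w)) \<longlonglongrightarrow> complex_of_real ((L2_norm f)\<^sup>2)" for w
      by (intro A_lim) (auto intro!: tendsto_eq_intros \<sigma>_lim)
    then show "AE w in lborel. (\<lambda>n. complex_of_real (gauss w) * A ((\<sigma> n / (2 * pi)) *\<^sub>R w)) \<longlonglongrightarrow>
        complex_of_real (gauss w) * complex_of_real ((L2_norm f)\<^sup>2)"
      by (intro AE_I2 tendsto_intros)
  qed measurable
  moreover have "(\<integral>w. gauss (w :: real ^ 'd) * complex_of_real ((L2_norm f)\<^sup>2) \<partial>lborel) = complex_of_real ((L2_norm f)\<^sup>2)"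
    by (simp only: integral_mult_left_zero integral_complex_of_real gauss_integral) simp
  ultimately have "(\<lambda>n. complex_of_real (\<integral>\<xi>. E n \<xi> \<partial>lborel)) \<longlonglongrightarrow> complex_of_real ((L2_norm f)\<^sup>2)"
    by (simp add: gauss_integral)
  then have E_lim: "(\<lambda>n. \<integral>\<xi>. E n \<xi> \<partial>lborel) \<longlonglongrightarrow> (L2_norm f)\<^sup>2"
    by (simp only: tendsto_of_real_iff)
  have E_mono: "mono (\<lambda>n. E n \<xi>)" for \<xi>
  proof (rule monoI)
    fix m n :: nat assume "m \<le> n"
    then have "\<sigma> n \<le> \<sigma> m" by (simp add: \<sigma>_def)
    then have "(norm (\<sigma> n *\<^sub>R \<xi>))\<^sup>2 \<le> (norm (\<sigma> m *\<^sub>R \<xi>))\<^sup>2"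
      using \<sigma>[of n] \<sigma>[of m] by (intro power_mono) (auto intro!: mult_right_mono)
    then show "E m \<xi> \<le> E n \<xi>"
      unfolding E_def by (intro mult_right_mono) auto
  qed
  have E_point: "(\<lambda>n. E n \<xi>) \<longlonglongrightarrow> (cmod (fourier_L1 f \<xi>))\<^sup>2" for \<xi>
    unfolding E_def by (auto intro!: tendsto_eq_intros \<sigma>_lim)
  have "integrable lborel (\<lambda>\<xi>. (cmod (fourier_L1 f \<xi>))\<^sup>2)"
    "(\<integral>\<xi>. (cmod (fourier_L1 f \<xi>))\<^sup>2 \<partial>lborel) = (L2_norm f)\<^sup>2"
    by (rule integrable_monotone_convergence integral_monotone_convergence;
      use E_int E_mono E_point E_lim in \<open>(simp | measurable)\<close>)+
  then have "integrable lebesgue (\<lambda>\<xi>. (cmod (fourier_L1 f \<xi>))\<^sup>2)"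
    "(\<integral>\<xi>. (cmod (fourier_L1 f \<xi>))\<^sup>2 \<partial>lebesgue) = (L2_norm f)\<^sup>2"
    by (simp_all add: integrable_completion integral_completion)
  moreover have "fourier_L1 f \<in> borel_measurable lebesgue"
    using Fm by (simp add: measurable_completion)
  ultimately show "fourier_L1 f \<in> L2_space" "L2_norm (fourier_L1 f) = L2_norm f"
    by (simp_all add: L2_space_def L2_norm_def real_sqrt_unique)
qed

lemma fourier_L1_cong_AE:
  fixes f h :: "real ^ 'd \<Rightarrow> complex"
  assumes "f \<in> borel_measurable lebesgue" "h \<in> borel_measurable lebesgue" "AE x in lebesgue. f x = h x"
  shows "fourier_L1 f = fourier_L1 h"
proof (rule ext)
  fix \<xi> :: "real ^ 'd"
  have "(\<lambda>x. char_fun (- (\<xi> \<bullet> x))) \<in> borel_measurable lborel" by measurable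
  then have "(\<lambda>x. char_fun (- (\<xi> \<bullet> x))) \<in> borel_measurable lebesgue"
    by (rule measurable_completion)
  with assms(1,2) show "fourier_L1 f \<xi> = fourier_L1 h \<xi>"
    unfolding fourier_L1_eq
    by (intro integral_cong_AE borel_measurable_times) (use assms(3) in \<open>auto elim: eventually_mono\<close>)
qed

theorem Plancherel:
  fixes f :: "real ^ 'd \<Rightarrow> complex"
  assumes f: "integrable lebesgue f" and f2: "f \<in> L2_space"
  shows "fourier_L1 f \<in> L2_space" "L2_norm (fourier_L1 f) = L2_norm f"
proof -
  obtain f' where f': "f' \<in> borel_measurable borel" "f' \<in> L2_space" "AE x in lebesgue. f x = f' x"
    using L2_borel_representative[OF f2] .
  have m: "f \<in> borel_measurable lebesgue" "f' \<in> borel_measurable lebesgue"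
    using f2 f'(2) by (auto simp: L2_space_def)
  have "integrable lebesgue f'"
    by (rule integrable_cong_AE_imp[OF f m(2) f'(3)])
  then have i: "integrable lborel f'"
    using f'(1) by (simp add: integrable_completion)
  have "L2_norm f = L2_norm f'"
    unfolding L2_norm_def using m f'(3)
    by (intro arg_cong[where f = sqrt] integral_cong_AE) (auto elim: eventually_mono)
  then show "fourier_L1 f \<in> L2_space" "L2_norm (fourier_L1 f) = L2_norm f"
    using Plancherel_borel[OF f'(1) i f'(2)] fourier_L1_cong_AE[OF m f'(3)] by simp_all
qed

lemma fourier_L1_diff:
  fixes f h :: "real ^ 'd \<Rightarrow> complex"
  assumes "integrable lebesgue f" "integrable lebesgue h"
  shows "fourier_L1 (\<lambda>x. f x - h x) = (\<lambda>\<xi>. fourier_L1 f \<xi> - fourier_L1 h \<xi>)"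
proof
  fix \<xi> :: "real ^ 'd"
  have m: "(\<lambda>x. char_fun (- (\<xi> \<bullet> x))) \<in> borel_measurable lebesgue"
    by (rule measurable_completion) measurable
  have "integrable lebesgue (\<lambda>x. k x * char_fun (- (\<xi> \<bullet> x)))" if "integrable lebesgue k" for k
    by (rule Bochner_Integration.integrable_bound[OF that])
      (use that m in \<open>auto simp: norm_mult\<close>)
  with assms show "fourier_L1 (\<lambda>x. f x - h x) \<xi> = fourier_L1 f \<xi> - fourier_L1 h \<xi>"
    unfolding fourier_L1_eq by (simp add: left_diff_distrib)
qed

section \<open>Completeness of \<open>L\<^sup>2\<close> and the Fourier transform on \<open>L\<^sup>2\<close>\<close>

lemma nn_integral_L2:
  assumes "f \<in> L2_space"
  shows "(\<integral>\<^sup>+x. ennreal ((cmod (f x))\<^sup>2) \<partial>lebesgue) = ennreal ((L2_norm f)\<^sup>2)"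
  using assms by (simp add: L2_norm_power2 nn_integral_eq_integral L2_space_def)

lemma L2_norm_le_if_nn_integral_le:
  assumes m: "f \<in> borel_measurable lebesgue" and "B \<ge> 0"
    and le: "(\<integral>\<^sup>+x. ennreal ((cmod (f x))\<^sup>2) \<partial>lebesgue) \<le> ennreal (B\<^sup>2)"
  shows "f \<in> L2_space" "L2_norm f \<le> B"
proof -
  have "integrable lebesgue (\<lambda>x. (cmod (f x))\<^sup>2)"
    using m le_less_trans[OF le ennreal_less_top] by (intro integrableI_bounded) (auto simp: less_top)
  with m show f: "f \<in> L2_space" by (simp add: L2_space_def)
  have "(L2_norm f)\<^sup>2 \<le> B\<^sup>2"
    using le by (simp add: nn_integral_L2[OF f])
  then show "L2_norm f \<le> B" using \<open>B \<ge> 0\<close> by (rule power2_le_imp_le)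
qed

lemma L2_Fatou:
  assumes s: "\<And>k::nat. s k \<in> L2_space" and m: "t \<in> borel_measurable lebesgue"
    and lim: "AE x in lebesgue. (\<lambda>k. s k x) \<longlonglongrightarrow> t x"
    and B: "\<forall>\<^sub>F k in sequentially. L2_norm (s k) \<le> B"
  shows "t \<in> L2_space" "L2_norm t \<le> B"
proof -
  obtain k where "L2_norm (s k) \<le> B" using B by (auto simp: eventually_sequentially)
  then have "B \<ge> 0" using L2_norm_nonneg order_trans by blast
  have sm: "(\<lambda>x. ennreal ((cmod (s k x))\<^sup>2)) \<in> borel_measurable lebesgue" for k
    using s[of k] unfolding L2_space_def by (auto intro: measurable_compose[OF borel_measurable_integrable])
  have "(\<integral>\<^sup>+x. ennreal ((cmod (t x))\<^sup>2) \<partial>lebesgue) = (\<integral>\<^sup>+x. liminf (\<lambda>k. ennreal ((cmod (s k x))\<^sup>2)) \<partial>lebesgue)"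
  proof (rule nn_integral_cong_AE)
    show "AE x in lebesgue. ennreal ((cmod (t x))\<^sup>2) = liminf (\<lambda>k. ennreal ((cmod (s k x))\<^sup>2))"
      using lim
    proof eventually_elim
      case (elim x)
      then have "(\<lambda>k. ennreal ((cmod (s k x))\<^sup>2)) \<longlonglongrightarrow> ennreal ((cmod (t x))\<^sup>2)"
        by (intro tendsto_ennrealI tendsto_power tendsto_norm)
      from lim_imp_Liminf[OF _ this] show ?case by simp
    qed
  qed
  also have "\<dots> \<le> liminf (\<lambda>k. \<integral>\<^sup>+x. ennreal ((cmod (s k x))\<^sup>2) \<partial>lebesgue)"
    by (rule nn_integral_liminf[OF sm])
  also have "\<dots> \<le> limsup (\<lambda>k. \<integral>\<^sup>+x. ennreal ((cmod (s k x))\<^sup>2) \<partial>lebesgue)"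
    by (rule Liminf_le_Limsup) simp
  also have "\<dots> \<le> ennreal (B\<^sup>2)"
  proof (rule Limsup_bounded)
    show "\<forall>\<^sub>F k in sequentially. (\<integral>\<^sup>+x. ennreal ((cmod (s k x))\<^sup>2) \<partial>lebesgue) \<le> ennreal (B\<^sup>2)"
      using B by eventually_elim (simp add: nn_integral_L2[OF s] ennreal_leI power_mono)
  qed
  finally show "t \<in> L2_space" "L2_norm t \<le> B"
    using L2_norm_le_if_nn_integral_le[OF m \<open>B \<ge> 0\<close>] by blast+
qed

text \<open>The weights \<open>2 ^ k\<close> grow more slowly than the squared norms of the increments decay, so the weighted
  sum of the squared increments has a finite integral and is finite almost everywhere. A large
  weight makes the increments themselves summable there.\<close>

lemma L2_pointwise_Cauchy:
  assumes G: "\<And>k::nat. G k \<in> L2_space"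
    and le: "\<And>k. L2_norm (\<lambda>x. G (Suc k) x - G k x) \<le> (1/4) ^ k"
  shows "AE x in lebesgue. convergent (\<lambda>k. G k x)"
proof -
  define D where "D k x = cmod (G (Suc k) x - G k x)" for k x
  have D_sq: "(\<integral>\<^sup>+x. ennreal ((D k x)\<^sup>2) \<partial>lebesgue) \<le> ennreal (((1/4) ^ k)\<^sup>2)" for k
    unfolding D_def nn_integral_L2[OF L2_diff[OF G G]]
    by (intro ennreal_leI power_mono le) simp
  have Dm: "(\<lambda>x. D k x) \<in> borel_measurable lebesgue" for k
  proof -
    have "(\<lambda>x. G (Suc k) x - G k x) \<in> borel_measurable lebesgue"
      using L2_diff[OF G[of "Suc k"] G[of k]] by (simp add: L2_space_def)
    then show ?thesis unfolding D_def by measurable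
  qed
  have wm: "(\<lambda>x. ennreal (2 ^ k) * ennreal ((D k x)\<^sup>2)) \<in> borel_measurable lebesgue" for k
    using Dm[of k] by measurable
  have "(\<integral>\<^sup>+x. (\<Sum>k. ennreal (2 ^ k) * ennreal ((D k x)\<^sup>2)) \<partial>lebesgue) =
      (\<Sum>k. \<integral>\<^sup>+x. ennreal (2 ^ k) * ennreal ((D k x)\<^sup>2) \<partial>lebesgue)"
    by (rule nn_integral_suminf[OF wm])
  also have "\<dots> \<le> (\<Sum>k. ennreal ((1/8) ^ k))"
  proof (rule suminf_le)
    fix k
    have "(\<lambda>x. ennreal ((D k x)\<^sup>2)) \<in> borel_measurable lebesgue"
      using Dm[of k] by measurable
    then have "(\<integral>\<^sup>+x. ennreal (2 ^ k) * ennreal ((D k x)\<^sup>2) \<partial>lebesgue) =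
        ennreal (2 ^ k) * (\<integral>\<^sup>+x. ennreal ((D k x)\<^sup>2) \<partial>lebesgue)"
      by (rule nn_integral_cmult)
    also have "\<dots> \<le> ennreal (2 ^ k) * ennreal (((1/4) ^ k)\<^sup>2)"
      by (intro mult_left_mono D_sq) simp
    also have "\<dots> = ennreal (2 ^ k * ((1/4) ^ k)\<^sup>2)"
      by (simp add: ennreal_mult)
    also have "(2::real) ^ k * ((1/4) ^ k)\<^sup>2 = (2 * (1/4)\<^sup>2) ^ k"
      by (simp only: power_mult_distrib power_mult[symmetric] mult.commute[of k])
    finally show "(\<integral>\<^sup>+x. ennreal (2 ^ k) * ennreal ((D k x)\<^sup>2) \<partial>lebesgue) \<le> ennreal ((1/8) ^ k)"
      by (simp add: power2_eq_square)
  qed auto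
  also have "\<dots> < \<infinity>"
    by (subst suminf_ennreal2) (auto intro: summable_geometric)
  finally have "AE x in lebesgue. (\<Sum>k. ennreal (2 ^ k) * ennreal ((D k x)\<^sup>2)) \<noteq> \<infinity>"
    using borel_measurable_suminf_order[OF wm] by (intro nn_integral_noteq_infinite) auto
  then show ?thesis
  proof eventually_elim
    case (elim x)
    have sum1: "summable (\<lambda>k. 2 ^ k * (D k x)\<^sup>2)"
    proof (rule summable_suminf_not_top)
      show "(\<Sum>k. ennreal (2 ^ k * (D k x)\<^sup>2)) \<noteq> top"
        using elim by (simp add: ennreal_mult)
    qed simp
    have sum2: "summable (\<lambda>k. (1/2) ^ k + 2 ^ k * (D k x)\<^sup>2)"
      by (intro summable_add sum1 summable_geometric) simp
    \<comment> \<open>An increment exceeding \<open>1 / 2 ^ k\<close> is dominated by its weighted square.\<close>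
    have "D k x \<le> (1/2) ^ k + 2 ^ k * (D k x)\<^sup>2" for k
    proof (cases "2 ^ k * D k x \<le> 1")
      case True
      then have "D k x \<le> (1/2) ^ k" by (simp add: field_simps)
      then show ?thesis by (simp add: add_increasing2)
    next
      case False
      have "1 * D k x \<le> (2 ^ k * D k x) * D k x"
        using False by (intro mult_right_mono) (auto simp: D_def)
      then show ?thesis by (simp add: power2_eq_square add_increasing mult.assoc)
    qed
    then have "summable (\<lambda>k. norm (G (Suc k) x - G k x))"
      by (intro summable_comparison_test'[OF sum2]) (simp add: D_def)
    then have "summable (\<lambda>k. G (Suc k) x - G k x)"
      by (rule summable_norm_cancel)
    then have "convergent (\<lambda>n. \<Sum>k<n. G (Suc k) x - G k x)"
      by (simp add: summable_iff_convergent)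
    moreover have "(\<Sum>k<n. G (Suc k) x - G k x) = G n x - G 0 x" for n
      using sum_lessThan_telescope[of "\<lambda>k. G k x" n] by simp
    ultimately have "convergent (\<lambda>n. G n x - G 0 x)"
      by simp
    then have "convergent (\<lambda>n. (G n x - G 0 x) + G 0 x)"
      by (intro convergent_add convergent_const)
    then show ?case by simp
  qed
qed

text \<open>A rapidly converging subsequence has a limit almost everywhere, and Fatou's lemma shows that the
  whole sequence approaches it in norm.\<close>

theorem Riesz_Fischer:
  assumes F: "\<And>n::nat. F n \<in> L2_space"
    and Cauchy: "\<And>e. e > 0 \<Longrightarrow> \<exists>N. \<forall>m\<ge>N. \<forall>n\<ge>N. L2_norm (\<lambda>x. F m x - F n x) < e"
  obtains h where "h \<in> L2_space" "(\<lambda>n. L2_norm (\<lambda>x. F n x - h x)) \<longlonglongrightarrow> 0"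
proof -
  have "\<exists>N. \<forall>m\<ge>N. \<forall>n\<ge>N. L2_norm (\<lambda>x. F m x - F n x) < (1/4) ^ k" for k
    by (rule Cauchy) simp
  then obtain N where N: "\<And>k m n. m \<ge> N k \<Longrightarrow> n \<ge> N k \<Longrightarrow> L2_norm (\<lambda>x. F m x - F n x) < (1/4) ^ k"
    by metis
  \<comment> \<open>The partial sums dominate every \<open>N k\<close> and are monotone.\<close>
  define r where "r k = (\<Sum>i\<le>k. N i)" for k
  have r: "r k \<ge> N k" "r (Suc k) \<ge> r k" for k
    using member_le_sum[of k "{..k}" N] by (auto simp: r_def)
  define G where "G k = F (r k)" for k
  have G: "G k \<in> L2_space" for k by (simp add: G_def F)
  have "L2_norm (\<lambda>x. G (Suc k) x - G k x) \<le> (1/4) ^ k" for k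
    unfolding G_def using r[of k] by (intro N[THEN less_imp_le]) linarith+
  then have conv: "AE x in lebesgue. convergent (\<lambda>k. G k x)"
    by (intro L2_pointwise_Cauchy G)
  define h where "h x = lim (\<lambda>k. G k x)" for x
  have Gm: "G k \<in> borel_measurable lebesgue" for k using G[of k] by (simp add: L2_space_def)
  have hm: "h \<in> borel_measurable lebesgue"
    unfolding h_def[abs_def] by (rule borel_measurable_lim_metric[OF Gm])
  have h: "AE x in lebesgue. (\<lambda>k. G k x) \<longlonglongrightarrow> h x"
    using conv by eventually_elim (simp add: h_def convergent_LIMSEQ_iff)
  have close: "(\<lambda>x. F n x - h x) \<in> L2_space \<and> L2_norm (\<lambda>x. F n x - h x) \<le> (1/4) ^ k" if "n \<ge> N k" for n k
  proof -
    have "(\<lambda>x. F n x - h x) \<in> borel_measurable lebesgue"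
      using F[of n] hm by (intro borel_measurable_diff) (auto simp: L2_space_def)
    moreover have "AE x in lebesgue. (\<lambda>j. F n x - G j x) \<longlonglongrightarrow> F n x - h x"
      using h by eventually_elim (intro tendsto_intros)
    moreover have "\<forall>\<^sub>F j in sequentially. L2_norm (\<lambda>x. F n x - G j x) \<le> (1/4) ^ k"
      using eventually_ge_at_top[of k]
    proof eventually_elim
      case (elim j)
      have "(\<Sum>i\<le>j. N i) \<ge> N k" using elim by (intro member_le_sum) auto
      then have "r j \<ge> N k" by (simp add: r_def)
      then show ?case unfolding G_def using that by (intro N[THEN less_imp_le])
    qed
    ultimately show ?thesis
      using L2_Fatou[of "\<lambda>j x. F n x - G j x"] L2_diff[OF F G] by blast
  qed
  have "(\<lambda>x. F (N 0) x - (F (N 0) x - h x)) \<in> L2_space"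
    by (rule L2_diff[OF F]) (use close[where n = "N 0" and k = 0] in simp)
  then have "h \<in> L2_space" by simp
  moreover have "(\<lambda>n. L2_norm (\<lambda>x. F n x - h x)) \<longlonglongrightarrow> 0"
  proof (rule LIMSEQ_I)
    fix e :: real assume "e > 0"
    then obtain k where k: "(1/4::real) ^ k < e"
      using real_arch_pow_inv[of e "1/4"] by auto
    then show "\<exists>no. \<forall>n\<ge>no. norm (L2_norm (\<lambda>x. F n x - h x) - 0) < e"
      using close[of k] by (intro exI[of _ "N k"]) (auto intro: le_less_trans)
  qed
  ultimately show ?thesis by (rule that)
qed

text \<open>By Plancherel's theorem the transforms of the truncations of \<open>g\<close> form a Cauchy sequence; its limit
  shows that the choice in \<^const>\<open>fourier_L2\<close> is made from a nonempty set.\<close>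

lemma is_fourier_L2_fourier_L2:
  assumes g: "g \<in> L2_space"
  shows "is_fourier_L2 g (fourier_L2 g)"
proof -
  define f where "f n = truncate (real n) g" for n :: nat
  have gm: "g \<in> borel_measurable lebesgue" using g by (simp add: L2_space_def)
  have f: "f n \<in> L2_space" "integrable lebesgue (f n)" for n
    unfolding f_def by (auto intro: truncate_L2 g truncate_integrable gm)
  have F: "fourier_L1 (f n) \<in> L2_space" for n
    by (intro Plancherel f)
  have f_lim: "(\<lambda>n. L2_norm (\<lambda>x. f n x - g x)) \<longlonglongrightarrow> 0"
    unfolding f_def by (rule truncate_tendsto[OF g])
  have isometry: "L2_norm (\<lambda>\<xi>. fourier_L1 (f m) \<xi> - fourier_L1 (f n) \<xi>) = L2_norm (\<lambda>x. f m x - f n x)" for m n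
    using Plancherel(2)[of "\<lambda>x. f m x - f n x"] f by (simp add: fourier_L1_diff L2_diff)
  obtain h where h: "h \<in> L2_space" "(\<lambda>n. L2_norm (\<lambda>\<xi>. fourier_L1 (f n) \<xi> - h \<xi>)) \<longlonglongrightarrow> 0"
  proof (rule Riesz_Fischer[of "\<lambda>n. fourier_L1 (f n)"])
    fix e :: real assume "e > 0"
    then have "e / 2 > 0" by simp
    from LIMSEQ_D[OF f_lim this] obtain N where N: "\<And>n. n \<ge> N \<Longrightarrow> L2_norm (\<lambda>x. f n x - g x) < e / 2"
      by auto
    have "L2_norm (\<lambda>x. f m x - f n x) < e" if "m \<ge> N" "n \<ge> N" for m n
      using L2_dist_triangle[OF f(1)[of m] f(1)[of n] g] N[OF that(1)] N[OF that(2)]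
        L2_norm_minus_commute[of g "f n"] by simp
    then show "\<exists>N. \<forall>m\<ge>N. \<forall>n\<ge>N. L2_norm (\<lambda>x. fourier_L1 (f m) x - fourier_L1 (f n) x) < e"
      unfolding isometry by blast
  qed (use F in auto)
  have "is_fourier_L2 g h"
    unfolding is_fourier_L2_def using h f F f_lim by blast
  then show ?thesis
    unfolding fourier_L2_def by (rule someI[of "is_fourier_L2 g"])
qed

lemma L2_modulate:
  fixes f :: "real ^ 'd \<Rightarrow> complex"
  assumes "f \<in> L2_space"
  shows "(\<lambda>x. f x * char_fun (b \<bullet> x)) \<in> L2_space"
proof -
  have "(\<lambda>x. char_fun (b \<bullet> x)) \<in> borel_measurable lebesgue"
    by (rule measurable_completion) measurable
  with assms show ?thesis
    by (auto simp: L2_space_def norm_mult)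
qed

lemma L2_norm_modulate: "L2_norm (\<lambda>x. f x * char_fun (b \<bullet> x)) = L2_norm f"
  by (simp add: L2_norm_def norm_mult)

text \<open>Polarization: the norms of \<open>a - b\<close> and of \<open>a - \<i> b\<close> determine the real and the imaginary part of the
  inner product.\<close>

lemma Plancherel_inner:
  assumes a: "integrable lebesgue a" "a \<in> L2_space" and b: "integrable lebesgue b" "b \<in> L2_space"
  shows "L2_inner (fourier_L1 a) (fourier_L1 b) = L2_inner a b"
proof (rule complex_eqI)
  have Re_eq: "Re (L2_inner (fourier_L1 a) (fourier_L1 k)) = Re (L2_inner a k)"
    if k: "integrable lebesgue k" "k \<in> L2_space" for k
  proof -
    have "(L2_norm (\<lambda>\<xi>. fourier_L1 a \<xi> - fourier_L1 k \<xi>))\<^sup>2 = (L2_norm (\<lambda>x. a x - k x))\<^sup>2"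
      using Plancherel(2)[of "\<lambda>x. a x - k x"] a k by (simp add: fourier_L1_diff L2_diff)
    then show ?thesis
      using a k by (simp add: L2_norm_diff_power2 Plancherel)
  qed
  then show "Re (L2_inner (fourier_L1 a) (fourier_L1 b)) = Re (L2_inner a b)" using b by simp
  have imag: "L2_inner k (\<lambda>x. \<i> * k' x) = - \<i> * L2_inner k k'" for k k' :: "real ^ 'a \<Rightarrow> complex"
  proof -
    have "L2_inner k (\<lambda>x. \<i> * k' x) = cnj (\<i> * L2_inner k' k)"
      by (subst L2_inner_commute) (simp only: L2_inner_scale_left)
    then show ?thesis by (simp add: L2_inner_commute[of k k'])
  qed
  have "fourier_L1 (\<lambda>x. \<i> * b x) = (\<lambda>\<xi>. \<i> * fourier_L1 b \<xi>)"
    by (simp add: fun_eq_iff fourier_L1_eq mult.assoc)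
  then show "Im (L2_inner (fourier_L1 a) (fourier_L1 b)) = Im (L2_inner a b)"
    using Re_eq[of "\<lambda>x. \<i> * b x"] b by (simp add: imag L2_scale)
qed

lemma fourier_L1_translate:
  assumes "f \<in> borel_measurable lebesgue"
  shows "fourier_L1 (\<lambda>x. f (x - t)) \<xi> = fourier_L1 f \<xi> * char_fun (- t \<bullet> \<xi>)"
proof -
  let ?k = "\<lambda>x. f (x - t) * char_fun (- (\<xi> \<bullet> x))"
  have "(\<lambda>x. char_fun (- (\<xi> \<bullet> x))) \<in> borel_measurable lebesgue"
    by (rule measurable_completion) measurable
  then have "?k \<in> borel_measurable lebesgue"
    using borel_measurable_lebesgue_translation[OF assms, of "-t"] by simp
  from lebesgue_integral_translation[OF this, of t]
  have "fourier_L1 (\<lambda>x. f (x - t)) \<xi> = (\<integral>x. f x * char_fun (- (\<xi> \<bullet> (x + t))) \<partial>lebesgue)"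
    by (simp add: fourier_L1_eq)
  also have "\<dots> = (\<integral>x. (f x * char_fun (- (\<xi> \<bullet> x))) * char_fun (- t \<bullet> \<xi>) \<partial>lebesgue)"
    by (intro Bochner_Integration.integral_cong refl)
      (simp add: cis_mult inner_add_right inner_commute algebra_simps)
  finally show ?thesis
    by (simp only: integral_mult_left_zero fourier_L1_eq)
qed

text \<open>On \<open>L\<^sup>1 \<inter> L\<^sup>2\<close> the transform is isometric and turns translations into modulations; both sides are
  continuous under the limits in \<^const>\<open>is_fourier_L2\<close>.\<close>

lemma fourier_L2_inner_translates:
  assumes g: "g \<in> L2_space" and h: "is_fourier_L2 g h"
  shows "L2_inner (\<lambda>\<xi>. h \<xi> * char_fun (- t \<bullet> \<xi>)) (\<lambda>\<xi>. h \<xi> * char_fun (- t' \<bullet> \<xi>)) =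
    L2_inner (\<lambda>x. g (x - t)) (\<lambda>x. g (x - t'))"
proof -
  obtain f :: "nat \<Rightarrow> real ^ 'a \<Rightarrow> complex" where f: "\<And>n. f n \<in> L2_space" "\<And>n. integrable lebesgue (f n)"
      "\<And>n. fourier_L1 (f n) \<in> L2_space"
    and f_lim: "(\<lambda>n. L2_norm (\<lambda>x. f n x - g x)) \<longlonglongrightarrow> 0"
    and F_lim: "(\<lambda>n. L2_norm (\<lambda>\<xi>. fourier_L1 (f n) \<xi> - h \<xi>)) \<longlonglongrightarrow> 0" and h2: "h \<in> L2_space"
    using h unfolding is_fourier_L2_def by blast
  let ?T = "\<lambda>t f x. f (x - t)" and ?M = "\<lambda>t f \<xi>. f \<xi> * char_fun (- t \<bullet> \<xi>)"
  have T: "(\<lambda>n. L2_norm (\<lambda>x. ?T t (f n) x - ?T t g x)) \<longlonglongrightarrow> 0" for t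
    using f_lim L2_norm_translate[OF L2_diff[OF f(1) g]] by simp
  have M: "(\<lambda>n. L2_norm (\<lambda>x. ?M t (fourier_L1 (f n)) x - ?M t h x)) \<longlonglongrightarrow> 0" for t
    unfolding left_diff_distrib[symmetric] L2_norm_modulate by (rule F_lim)
  have "fourier_L1 (?T t (f n)) = ?M t (fourier_L1 (f n))" for n t
    using f(1)[of n] by (intro ext fourier_L1_translate) (simp add: L2_space_def)
  moreover have "integrable lebesgue (?T t (f n))" for n t
    using lebesgue_integrable_translation[OF f(2)[of n], of "-t"] by simp
  ultimately have eq: "L2_inner (?M t (fourier_L1 (f n))) (?M t' (fourier_L1 (f n))) =
      L2_inner (?T t (f n)) (?T t' (f n))" for n
    using Plancherel_inner[of "?T t (f n)" "?T t' (f n)"] by (simp add: L2_translate f)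
  have "(\<lambda>n. L2_inner (?M t (fourier_L1 (f n))) (?M t' (fourier_L1 (f n)))) \<longlonglongrightarrow>
      L2_inner (?M t h) (?M t' h)"
    by (intro L2_inner_tendsto L2_modulate f h2 M)
  moreover have "(\<lambda>n. L2_inner (?T t (f n)) (?T t' (f n))) \<longlonglongrightarrow> L2_inner (?T t g) (?T t' g)"
    by (intro L2_inner_tendsto L2_translate f g T)
  ultimately show ?thesis
    unfolding eq by (rule LIMSEQ_unique)
qed

section \<open>Counting points in cubes\<close>

definition cube :: "real ^ 'd \<Rightarrow> real \<Rightarrow> (real ^ 'd) set" where
  "cube x r = cbox x (x + (\<chi> i. r))"

text \<open>The counting measure, unlike \<^const>\<open>card\<close>, gives infinite sets the value \<open>\<infinity>\<close>. This matters because the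
  local finiteness of the sets \<open>T\<close> and \<open>S\<close> is a conclusion.\<close>

definition count_in :: "'a set \<Rightarrow> 'a set \<Rightarrow> ennreal" where
  "count_in \<Lambda> A = emeasure (count_space \<Lambda>) (\<Lambda> \<inter> A)"

lemma mem_cube: "z \<in> cube x r \<longleftrightarrow> (\<forall>i. x $ i \<le> z $ i \<and> z $ i \<le> x $ i + r)"
  by (simp add: cube_def mem_box_cart)

lemma cube_measurable [measurable]: "cube x r \<in> sets borel"
  by (simp add: cube_def)

lemma emeasure_cube:
  assumes "r \<ge> 0"
  shows "emeasure lborel (cube (x :: real ^ 'd) r) = ennreal (r ^ CARD('d))"
proof -
  have "cbox x (x + (\<chi> i. r)) \<noteq> {}"
    using assms by (auto simp: interval_ne_empty_cart)
  then have "measure lborel (cube x r) = r ^ CARD('d)"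
    by (simp add: cube_def content_cbox_cart)
  then show ?thesis
    using emeasure_lborel_cbox_finite[of x "x + (\<chi> i. r)"]
    by (simp add: emeasure_eq_ennreal_measure cube_def)
qed

text \<open>The shift of a cube by a vector with entries of modulus at most \<open>m\<close> stays between the cubes with
  sides shorter and longer by \<open>2 * m\<close>; both comparisons are instances of this inclusion.\<close>

lemma cube_subset_shifted:
  assumes "\<And>i. \<bar>u $ i\<bar> \<le> m"
  shows "cube x r \<subseteq> cube (x - (\<chi> i. m) + u) (r + 2 * m)"
proof
  fix z assume z: "z \<in> cube x r"
  show "z \<in> cube (x - (\<chi> i. m) + u) (r + 2 * m)"
    unfolding mem_cube
  proof
    fix i
    show "(x - (\<chi> i. m) + u) $ i \<le> z $ i \<and> z $ i \<le> (x - (\<chi> i. m) + u) $ i + (r + 2 * m)"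
      using z[unfolded mem_cube, rule_format, of i] assms[of i] by (simp add: abs_le_iff)
  qed
qed

lemma count_in_mono: "A \<subseteq> B \<Longrightarrow> count_in \<Lambda> A \<le> count_in \<Lambda> B"
  unfolding count_in_def by (intro emeasure_mono) auto

lemma count_in_eq:
  "count_in \<Lambda> A = (if finite (\<Lambda> \<inter> A) then ennreal (real (card (\<Lambda> \<inter> A))) else top)"
  by (simp add: count_in_def emeasure_count_space ennreal_of_nat_eq_real_of_nat)

lemma count_in_Times: "count_in (T \<times> S) (A \<times> B) = count_in T A * count_in S B"
proof -
  have "(T \<times> S) \<inter> (A \<times> B) = (T \<inter> A) \<times> (S \<inter> B)" by auto
  then show ?thesis
    by (auto simp: count_in_eq card_cartesian_product finite_cartesian_product_iff
        ennreal_mult_top ennreal_top_mult ennreal_mult card_eq_0_iff)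
qed

lemma nn_integral_lborel_reflect:
  fixes f :: "'a :: euclidean_space \<Rightarrow> ennreal"
  assumes [measurable]: "f \<in> borel_measurable borel"
  shows "(\<integral>\<^sup>+z. f (a - z) \<partial>lborel) = (\<integral>\<^sup>+z. f z \<partial>lborel)"
proof -
  have "(\<integral>\<^sup>+z. f z \<partial>lborel) = (\<integral>\<^sup>+z. f (a + (-1) *\<^sub>R z) \<partial>lborel)"
    by (subst lborel_affine[of "-1" a], simp, subst nn_integral_density) (auto simp: nn_integral_distr)
  then show ?thesis by simp
qed

text \<open>Interchange the sum and the integral and substitute \<open>z = l - w\<close> in each term.\<close>

lemma averaged_periodization:
  fixes \<phi> :: "'a :: euclidean_space \<Rightarrow> ennreal"
  assumes "countable \<Lambda>" and [measurable]: "\<phi> \<in> borel_measurable borel" "Q \<in> sets borel"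
  shows "(\<integral>\<^sup>+z. indicator Q z * (\<integral>\<^sup>+l. \<phi> (l - z) \<partial>count_space \<Lambda>) \<partial>lborel) =
    (\<integral>\<^sup>+w. \<phi> w * count_in \<Lambda> {l. l - w \<in> Q} \<partial>lborel)"
proof -
  have "(\<integral>\<^sup>+z. indicator Q z * (\<integral>\<^sup>+l. \<phi> (l - z) \<partial>count_space \<Lambda>) \<partial>lborel) =
      (\<integral>\<^sup>+z. (\<integral>\<^sup>+l. indicator Q z * \<phi> (l - z) \<partial>count_space \<Lambda>) \<partial>lborel)"
    by (simp add: nn_integral_cmult)
  also have "\<dots> = (\<integral>\<^sup>+l. (\<integral>\<^sup>+z. indicator Q z * \<phi> (l - z) \<partial>lborel) \<partial>count_space \<Lambda>)"
    by (rule nn_integral_count_space_nn_integral[OF assms(1)]) measurable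
  also have "\<dots> = (\<integral>\<^sup>+l. (\<integral>\<^sup>+w. \<phi> w * indicator Q (l - w) \<partial>lborel) \<partial>count_space \<Lambda>)"
  proof (rule nn_integral_cong)
    fix l
    have "(\<lambda>w. \<phi> w * indicator Q (l - w)) \<in> borel_measurable borel" by measurable
    from nn_integral_lborel_reflect[OF this, of l]
    show "(\<integral>\<^sup>+z. indicator Q z * \<phi> (l - z) \<partial>lborel) = (\<integral>\<^sup>+w. \<phi> w * indicator Q (l - w) \<partial>lborel)"
      by (simp add: mult.commute)
  qed
  also have "\<dots> = (\<integral>\<^sup>+w. (\<integral>\<^sup>+l. \<phi> w * indicator Q (l - w) \<partial>count_space \<Lambda>) \<partial>lborel)"
    by (rule nn_integral_count_space_nn_integral[OF assms(1), symmetric]) measurable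
  also have "\<dots> = (\<integral>\<^sup>+w. \<phi> w * count_in \<Lambda> {l. l - w \<in> Q} \<partial>lborel)"
  proof (rule nn_integral_cong)
    fix w
    have "(\<integral>\<^sup>+l. \<phi> w * indicator Q (l - w) \<partial>count_space \<Lambda>) =
        \<phi> w * (\<integral>\<^sup>+l. indicator (\<Lambda> \<inter> {l. l - w \<in> Q}) l \<partial>count_space \<Lambda>)"
      by (subst nn_integral_cmult[symmetric]) (auto intro!: nn_integral_cong split: split_indicator)
    also have "\<dots> = \<phi> w * count_in \<Lambda> {l. l - w \<in> Q}"
      unfolding count_in_def by (subst nn_integral_indicator) auto
    finally show "(\<integral>\<^sup>+l. \<phi> w * indicator Q (l - w) \<partial>count_space \<Lambda>) =
      \<phi> w * count_in \<Lambda> {l. l - w \<in> Q}" .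
  qed
  finally show ?thesis .
qed

section \<open>Densities of the two factors\<close>

text \<open>\<open>\<phi>\<close> is a probability density with respect to which the product of the numbers of points of \<open>T\<close> and
  \<open>S\<close> in two randomly shifted cubes has exactly the expectation \<open>r\<^sup>d R\<^sup>d\<close>. The conclusions drawn here
  depend on the Gabor basis only through this identity.\<close>

locale averaged_counts =
  fixes T S :: "(real ^ 'd) set" and \<phi> :: "(real ^ 'd) \<times> (real ^ 'd) \<Rightarrow> ennreal"
  assumes \<phi>_measurable [measurable]: "\<phi> \<in> borel_measurable borel"
    and \<phi>_mass: "(\<integral>\<^sup>+w. \<phi> w \<partial>lborel) = 1"
    and average: "\<And>x y r R. r \<ge> 0 \<Longrightarrow> R \<ge> 0 \<Longrightarrow>
      (\<integral>\<^sup>+w. \<phi> w * (count_in T (cube (x + fst w) r) * count_in S (cube (y + snd w) R)) \<partial>lborel) =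
      ennreal (r ^ CARD('d) * R ^ CARD('d))"
begin

definition \<nu> where "\<nu> = density lborel \<phi>"

lemma sets_\<nu> [measurable_cong, simp]: "sets \<nu> = sets borel" by (simp add: \<nu>_def)
lemma space_\<nu> [simp]: "space \<nu> = UNIV" by (simp add: \<nu>_def)

lemma \<nu>_eq: "A \<in> sets borel \<Longrightarrow> emeasure \<nu> A = (\<integral>\<^sup>+w. \<phi> w * indicator A w \<partial>lborel)"
  unfolding \<nu>_def by (rule emeasure_density) auto

sublocale \<nu>: prob_space \<nu>
  by (rule prob_spaceI) (simp add: \<nu>_eq \<phi>_mass)

lemma tight:
  assumes "\<delta> > 0"
  obtains m where "m > 0" "measure \<nu> (cball 0 m) > 1 - \<delta>"
proof -
  have "(\<lambda>n. measure \<nu> (cball 0 (real n))) \<longlonglongrightarrow> measure \<nu> (\<Union>n. cball 0 (real n))"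
    by (intro \<nu>.finite_Lim_measure_incseq) (auto simp: incseq_def)
  also have "(\<Union>n. cball 0 (real n)) = space \<nu>"
    using real_arch_simple by (auto simp: dist_norm)
  finally have "(\<lambda>n. measure \<nu> (cball 0 (real n))) \<longlonglongrightarrow> 1"
    using \<nu>.prob_space by simp
  then have "\<forall>\<^sub>F n in sequentially. measure \<nu> (cball 0 (real n)) > 1 - \<delta>"
    using assms by (intro order_tendstoD) auto
  with eventually_gt_at_top[of 0]
  have "\<forall>\<^sub>F n in sequentially. real n > 0 \<and> measure \<nu> (cball 0 (real n)) > 1 - \<delta>"
    by eventually_elim simp
  then obtain n where "real n > 0" "measure \<nu> (cball 0 (real n)) > 1 - \<delta>"
    by (auto simp: eventually_sequentially)
  then show ?thesis by (rule that)
qed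

lemma component_bound:
  assumes "w \<in> cball 0 m"
  shows "\<bar>fst w $ i\<bar> \<le> m" "\<bar>snd w $ i\<bar> \<le> m"
  using assms component_le_norm_cart[of "fst w" i] component_le_norm_cart[of "snd w" i]
    norm_fst_le[of "fst w" "snd w"] norm_snd_le[of "snd w" "fst w"] by (auto simp: dist_norm)

abbreviation "both x y r R \<equiv> count_in T (cube x r) * count_in S (cube y R)"

lemma cball_borel [measurable]: "cball (0 :: (real ^ 'd) \<times> (real ^ 'd)) m \<in> sets borel"
  by (rule borel_closed[OF closed_cball])

text \<open>For a shift in the ball of radius \<open>m\<close>, enlarged cubes contain the fixed ones, so the average is at
  least the product of the counts in the latter times the mass of the ball.\<close>

lemma counts_upper_ennreal:
  assumes "r \<ge> 0" "R \<ge> 0" "m \<ge> 0"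
  shows "emeasure \<nu> (cball 0 m) * both x y r R \<le> ennreal ((r + 2 * m) ^ CARD('d) * (R + 2 * m) ^ CARD('d))"
proof -
  let ?x = "x - (\<chi> i. m)" and ?y = "y - (\<chi> i. m)"
  have "emeasure \<nu> (cball 0 m) * both x y r R = (\<integral>\<^sup>+w. (\<phi> w * indicator (cball 0 m) w) * both x y r R \<partial>lborel)"
    by (subst nn_integral_multc, measurable) (subst \<nu>_eq, simp_all)
  also have "\<dots> \<le> (\<integral>\<^sup>+w. \<phi> w * both (?x + fst w) (?y + snd w) (r + 2 * m) (R + 2 * m) \<partial>lborel)"
  proof (rule nn_integral_mono)
    fix w :: "(real ^ 'd) \<times> (real ^ 'd)"
    show "(\<phi> w * indicator (cball 0 m) w) * both x y r R \<le>
      \<phi> w * both (?x + fst w) (?y + snd w) (r + 2 * m) (R + 2 * m)"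
    proof (cases "w \<in> cball 0 m")
      case True
      then have "both x y r R \<le> both (?x + fst w) (?y + snd w) (r + 2 * m) (R + 2 * m)"
        by (intro mult_mono count_in_mono cube_subset_shifted component_bound[OF True]) auto
      with True show ?thesis by (simp add: mult_left_mono)
    qed simp
  qed
  also have "\<dots> = ennreal ((r + 2 * m) ^ CARD('d) * (R + 2 * m) ^ CARD('d))"
    using assms by (intro average) auto
  finally show ?thesis .
qed

text \<open>The bound is useful as soon as the ball has positive mass. With one factor fixed and nonzero, it
  makes the other factor finite.\<close>

lemma counts_finite:
  assumes "r \<ge> 0" "R \<ge> 0"
  shows "both x y r R < top"
proof -
  obtain m where m: "m > 0" "measure \<nu> (cball 0 m) > 1 - 1/2" using tight[of "1/2"] by auto
  then have "emeasure \<nu> (cball 0 m) \<noteq> 0"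
    by (auto simp: measure_def)
  moreover have "emeasure \<nu> (cball 0 m) * both x y r R < top"
    by (rule le_less_trans[OF counts_upper_ennreal ennreal_less_top]) (use assms m in auto)
  ultimately show ?thesis
    by (auto simp: ennreal_mult_less_top ennreal_mult_eq_top_iff less_top[symmetric] top_unique)
qed

lemma counts_nonzero: "\<exists>x y. both x y 1 1 \<noteq> 0"
proof (rule ccontr)
  assume "\<not> ?thesis"
  then have z: "\<And>x y. both x y 1 1 = 0" by blast
  show False using average[of 1 1 0 0] unfolding z by simp
qed

lemma finite_T: "finite (T \<inter> cube x r)"
proof (cases "r \<ge> 0")
  case True
  obtain x' y where "both x' y 1 1 \<noteq> 0" using counts_nonzero by blast
  then have nz: "count_in S (cube y 1) \<noteq> 0" by auto
  have "count_in T (cube x r) \<noteq> top"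
  proof
    assume "count_in T (cube x r) = top"
    with nz counts_finite[OF True, of 1 x y] show False by (simp add: ennreal_top_mult)
  qed
  then show ?thesis by (simp add: count_in_eq split: if_splits)
next
  case False
  then have "cube x r = {}" by (auto simp: mem_cube) (meson add_le_cancel_left dual_order.trans le_add_same_cancel1)
  then show ?thesis by simp
qed

lemma finite_S: "finite (S \<inter> cube x r)"
proof (cases "r \<ge> 0")
  case True
  obtain x' y where "both x' y 1 1 \<noteq> 0" using counts_nonzero by blast
  then have nz: "count_in T (cube x' 1) \<noteq> 0" by auto
  have "count_in S (cube x r) \<noteq> top"
  proof
    assume "count_in S (cube x r) = top"
    with nz counts_finite[of 1 r x' x] True show False by (simp add: ennreal_mult_top)
  qed
  then show ?thesis by (simp add: count_in_eq split: if_splits)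
next
  case False
  then have "cube x r = {}" by (auto simp: mem_cube) (meson add_le_cancel_left dual_order.trans le_add_same_cancel1)
  then show ?thesis by simp
qed

abbreviation "nT r x \<equiv> real (card (T \<inter> cube x r))"
abbreviation "nS r x \<equiv> real (card (S \<inter> cube x r))"

lemma both_eq: "both x y r R = ennreal (nT r x * nS R y)"
  by (simp add: count_in_eq finite_T finite_S ennreal_mult)

lemma counts_upper:
  assumes "r \<ge> 0" "R \<ge> 0" "m \<ge> 0"
  shows "measure \<nu> (cball 0 m) * (nT r x * nS R y) \<le> (r + 2 * m) ^ CARD('d) * (R + 2 * m) ^ CARD('d)"
  using counts_upper_ennreal[OF assms, of x y] assms
  by (simp only: both_eq \<nu>.emeasure_eq_measure ennreal_mult[symmetric] measure_nonneg mult_nonneg_nonneg of_nat_0_le_iff)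
    (subst (asm) ennreal_le_iff, auto)

text \<open>Split the average over shrunken cubes according to whether the shift lies in the ball of radius \<open>m\<close>.
  Inside, the fixed cubes contain the shifted ones; outside, the upper bound for the counts is
  multiplied by the small mass of the complement.\<close>

lemma counts_lower:
  assumes "2 * m \<le> r" "2 * m \<le> R" "m \<ge> 0" and c: "measure \<nu> (cball 0 m) > 0"
  shows "(r - 2 * m) ^ CARD('d) * (R - 2 * m) ^ CARD('d) \<le>
    nT r x * nS R y + r ^ CARD('d) * R ^ CARD('d) / measure \<nu> (cball 0 m) * (1 - measure \<nu> (cball 0 m))"
proof -
  let ?K = "cball 0 m :: ((real ^ 'd) \<times> (real ^ 'd)) set"
  let ?c = "measure \<nu> ?K"
  let ?B = "r ^ CARD('d) * R ^ CARD('d) / ?c"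
  let ?x = "x + (\<chi> i. m)" and ?y = "y + (\<chi> i. m)"
  have B: "?B \<ge> 0" using assms c by simp
  have "ennreal ((r - 2 * m) ^ CARD('d) * (R - 2 * m) ^ CARD('d)) =
      (\<integral>\<^sup>+w. \<phi> w * both (?x + fst w) (?y + snd w) (r - 2 * m) (R - 2 * m) \<partial>lborel)"
    using assms by (intro average[symmetric]) auto
  also have "\<dots> \<le> (\<integral>\<^sup>+w. \<phi> w * indicator ?K w * ennreal (nT r x * nS R y) +
      \<phi> w * indicator (- ?K) w * ennreal ?B \<partial>lborel)"
  proof (rule nn_integral_mono)
    fix w :: "(real ^ 'd) \<times> (real ^ 'd)"
    let ?b = "both (?x + fst w) (?y + snd w) (r - 2 * m) (R - 2 * m)"
    show "\<phi> w * ?b \<le> \<phi> w * indicator ?K w * ennreal (nT r x * nS R y) + \<phi> w * indicator (- ?K) w * ennreal ?B"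
    proof (cases "w \<in> ?K")
      case True
      have "cube (?x + fst w) (r - 2 * m) \<subseteq> cube x r"
        using cube_subset_shifted[of "- fst w" m "?x + fst w" "r - 2 * m"] component_bound[OF True] by simp
      moreover have "cube (?y + snd w) (R - 2 * m) \<subseteq> cube y R"
        using cube_subset_shifted[of "- snd w" m "?y + snd w" "R - 2 * m"] component_bound[OF True] by simp
      ultimately have "?b \<le> both x y r R"
        by (intro mult_mono count_in_mono) auto
      with True show ?thesis by (simp add: both_eq mult_left_mono)
    next
      case False
      have "?c * (nT (r - 2 * m) (?x + fst w) * nS (R - 2 * m) (?y + snd w)) \<le> r ^ CARD('d) * R ^ CARD('d)"
        using counts_upper[of "r - 2 * m" "R - 2 * m" m] assms by simp
      then have "nT (r - 2 * m) (?x + fst w) * nS (R - 2 * m) (?y + snd w) \<le> ?B"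
        using c by (simp add: field_simps)
      then have "?b \<le> ennreal ?B" unfolding both_eq by (rule ennreal_leI)
      with False show ?thesis by (simp add: mult_left_mono)
    qed
  qed
  also have "\<dots> = emeasure \<nu> ?K * ennreal (nT r x * nS R y) + emeasure \<nu> (- ?K) * ennreal ?B"
  proof -
    have meas: "(\<lambda>w. \<phi> w * indicator A w) \<in> borel_measurable lborel" if "A \<in> sets borel" for A
      using that by measurable
    have K: "?K \<in> sets borel" "- ?K \<in> sets borel"
      by (auto intro: cball_borel borel_comp)
    show ?thesis
      by (subst nn_integral_add[OF borel_measurable_times_ennreal[OF meas borel_measurable_const]
            borel_measurable_times_ennreal[OF meas borel_measurable_const]])
        (simp_all only: K nn_integral_multc[OF meas[OF K(1)]] nn_integral_multc[OF meas[OF K(2)]] \<nu>_eq)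
  qed
  also have "emeasure \<nu> (- ?K) = ennreal (1 - ?c)"
    using \<nu>.prob_compl[of ?K] by (simp add: \<nu>.emeasure_eq_measure Compl_eq_Diff_UNIV)
  also have "emeasure \<nu> ?K * ennreal (nT r x * nS R y) + ennreal (1 - ?c) * ennreal ?B \<le>
      ennreal (nT r x * nS R y) + ennreal (1 - ?c) * ennreal ?B"
    using mult_right_mono[OF \<nu>.emeasure_le_1[of ?K], of "ennreal (nT r x * nS R y)"]
    by (intro add_right_mono) simp
  also have "\<dots> = ennreal (nT r x * nS R y) + ennreal ((1 - ?c) * ?B)"
    using \<nu>.prob_le_1[of ?K] B by (subst ennreal_mult) auto
  also have "\<dots> = ennreal (nT r x * nS R y + ?B * (1 - ?c))"
  proof -
    have "(1 - ?c) * ?B \<ge> 0" using \<nu>.prob_le_1[of ?K] B by (intro mult_nonneg_nonneg) auto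
    then have "ennreal (nT r x * nS R y) + ennreal ((1 - ?c) * ?B) = ennreal (nT r x * nS R y + (1 - ?c) * ?B)"
      by (intro ennreal_plus[symmetric]) auto
    then show ?thesis by (simp only: mult.commute[of ?B])
  qed
  finally have "ennreal ((r - 2 * m) ^ CARD('d) * (R - 2 * m) ^ CARD('d)) \<le> ennreal (nT r x * nS R y + ?B * (1 - ?c))" .
  moreover have "nT r x * nS R y + ?B * (1 - ?c) \<ge> 0"
    using \<nu>.prob_le_1[of ?K] B by (intro add_nonneg_nonneg mult_nonneg_nonneg) auto
  ultimately show ?thesis by (simp only: ennreal_le_iff)
qed

text \<open>Choose the ball first, so that its mass \<open>c\<close> is close to 1, and then cubes so large that enlarging or
  shrinking them by the radius of the ball changes their volume by a small factor.\<close>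

lemma asymptotic_product:
  assumes "\<epsilon> > 0"
  shows "\<exists>\<rho>>0. \<forall>r\<ge>\<rho>. \<forall>R\<ge>\<rho>. \<forall>x y.
    \<bar>nT r x / r ^ CARD('d) * (nS R y / R ^ CARD('d)) - 1\<bar> \<le> \<epsilon>"
proof -
  let ?d = "CARD('d)"
  \<comment> \<open>The product will be found to lie between \<open>1 - 3 * \<delta>\<close> and \<open>1 + 4 * \<delta>\<close>.\<close>
  define \<delta> where "\<delta> = min (1/2) (\<epsilon> / 4)"
  have \<delta>: "\<delta> > 0" "\<delta> \<le> 1/2" "4 * \<delta> \<le> \<epsilon>" using assms by (auto simp: \<delta>_def)
  obtain m where m: "m > 0" and c_gt: "measure \<nu> (cball 0 m) > 1 - \<delta>" using tight[OF \<delta>(1)] by auto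
  define c where "c = measure \<nu> (cball 0 m)"
  have c: "c \<ge> 1/2" "c \<le> 1" "1 - c \<le> \<delta>" "c > 0"
    using c_gt \<delta> by (auto simp: c_def)
  have lim: "((\<lambda>\<rho>. (1 + s * (2 * m / \<rho>)) ^ ?d * (1 + s * (2 * m / \<rho>)) ^ ?d) \<longlongrightarrow> (1 + s * 0) ^ ?d * (1 + s * 0) ^ ?d) at_top" for s
    by (intro tendsto_intros tendsto_divide_0[OF tendsto_const] filterlim_at_top_imp_at_infinity filterlim_ident)
  have "\<forall>\<^sub>F \<rho> in at_top. (1 + 1 * (2 * m / \<rho>)) ^ ?d * (1 + 1 * (2 * m / \<rho>)) ^ ?d < 1 + \<delta>"
    using lim[of 1] \<delta> by (intro order_tendstoD(2)) auto
  moreover have "\<forall>\<^sub>F \<rho> in at_top. (1 + (-1) * (2 * m / \<rho>)) ^ ?d * (1 + (-1) * (2 * m / \<rho>)) ^ ?d > 1 - \<delta>"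
    using lim[of "-1"] \<delta> by (intro order_tendstoD(1)) auto
  moreover have "\<forall>\<^sub>F \<rho> in at_top. \<rho> > 2 * m" by (rule eventually_gt_at_top)
  ultimately have "\<forall>\<^sub>F \<rho> in at_top. \<rho> > 2 * m \<and> (1 + 2 * m / \<rho>) ^ ?d * (1 + 2 * m / \<rho>) ^ ?d < 1 + \<delta> \<and>
      (1 - 2 * m / \<rho>) ^ ?d * (1 - 2 * m / \<rho>) ^ ?d > 1 - \<delta>"
    by eventually_elim simp
  then obtain \<rho> where \<rho>: "\<rho> > 2 * m" "(1 + 2 * m / \<rho>) ^ ?d * (1 + 2 * m / \<rho>) ^ ?d < 1 + \<delta>"
      "(1 - 2 * m / \<rho>) ^ ?d * (1 - 2 * m / \<rho>) ^ ?d > 1 - \<delta>"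
    by (auto simp: eventually_at_top_linorder)
  have "\<bar>nT r x / r ^ ?d * (nS R y / R ^ ?d) - 1\<bar> \<le> \<epsilon>" if r: "r \<ge> \<rho>" and R: "R \<ge> \<rho>" for r R x y
  proof -
    have pos: "r > 0" "R > 0" "\<rho> > 0" using m \<rho>(1) r R by linarith+
    have q: "2 * m / r \<le> 2 * m / \<rho>" "2 * m / R \<le> 2 * m / \<rho>" "0 \<le> 2 * m / r" "0 \<le> 2 * m / R" "2 * m / \<rho> \<le> 1"
      using pos r R m \<rho>(1) by (auto intro!: divide_left_mono)
    let ?P = "nT r x / r ^ ?d * (nS R y / R ^ ?d)"
    have P: "?P = nT r x * nS R y / (r ^ ?d * R ^ ?d)" by simp
    have scale: "(r + s * (2 * m)) ^ ?d * (R + s * (2 * m)) ^ ?d =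
        (1 + s * (2 * m / r)) ^ ?d * (1 + s * (2 * m / R)) ^ ?d * (r ^ ?d * R ^ ?d)" for s
    proof -
      have "r + s * (2 * m) = (1 + s * (2 * m / r)) * r" "R + s * (2 * m) = (1 + s * (2 * m / R)) * R"
        using pos by (simp_all add: field_simps)
      then show ?thesis by (simp only: power_mult_distrib mult_ac)
    qed
    have rR: "r ^ ?d * R ^ ?d > 0" using pos by simp
    have "c * (nT r x * nS R y) \<le> (1 + 2 * m / r) ^ ?d * (1 + 2 * m / R) ^ ?d * (r ^ ?d * R ^ ?d)"
      using counts_upper[of r R m x y] scale[of 1] pos m by (simp add: c_def)
    also have "\<dots> \<le> (1 + 2 * m / \<rho>) ^ ?d * (1 + 2 * m / \<rho>) ^ ?d * (r ^ ?d * R ^ ?d)"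
      using q rR by (intro mult_right_mono mult_mono power_mono) auto
    also have "\<dots> \<le> (1 + \<delta>) * (r ^ ?d * R ^ ?d)"
      using \<rho>(2) rR by (intro mult_right_mono) auto
    finally have "c * ?P \<le> 1 + \<delta>"
      unfolding P using rR by (simp add: pos_divide_le_eq mult.assoc)
    moreover have "?P * (1 - \<delta>) \<le> ?P * c"
      using c(3) by (intro mult_left_mono) (auto simp: pos less_imp_le intro!: mult_nonneg_nonneg divide_nonneg_nonneg)
    ultimately have up: "?P * (1 - \<delta>) \<le> 1 + \<delta>" by (simp add: mult.commute)
    have "1 + \<delta> \<le> (1 + 4 * \<delta>) * (1 - \<delta>)"
      using \<delta> mult_left_mono[of \<delta> "1/2" \<delta>] by (simp add: algebra_simps)
    with up have "?P * (1 - \<delta>) \<le> (1 + 4 * \<delta>) * (1 - \<delta>)" by linarith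
    then have P_le: "?P \<le> 1 + 4 * \<delta>"
      using \<delta> by (simp only: mult_le_cancel_right)
    have "(1 - \<delta>) * (r ^ ?d * R ^ ?d) \<le> (1 - 2 * m / \<rho>) ^ ?d * (1 - 2 * m / \<rho>) ^ ?d * (r ^ ?d * R ^ ?d)"
      using \<rho>(3) rR by (intro mult_right_mono) auto
    also have "\<dots> \<le> (1 - 2 * m / r) ^ ?d * (1 - 2 * m / R) ^ ?d * (r ^ ?d * R ^ ?d)"
      using q rR by (intro mult_right_mono mult_mono power_mono) auto
    also have "\<dots> = (r - 2 * m) ^ ?d * (R - 2 * m) ^ ?d"
      using scale[of "-1"] by simp
    also have "\<dots> \<le> nT r x * nS R y + r ^ ?d * R ^ ?d / c * (1 - c)"
      unfolding c_def using r R \<rho>(1) m c(4) by (intro counts_lower) (auto simp: c_def)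
    also have "r ^ ?d * R ^ ?d / c * (1 - c) \<le> (2 * \<delta>) * (r ^ ?d * R ^ ?d)"
    proof -
      have "(1 - c) / c \<le> \<delta> / (1/2)" using c \<delta> by (intro frac_le) auto
      then have "(1 - c) / c * (r ^ ?d * R ^ ?d) \<le> (2 * \<delta>) * (r ^ ?d * R ^ ?d)"
        using rR by (intro mult_right_mono) auto
      then show ?thesis by (simp add: mult_ac)
    qed
    finally have "(1 - 3 * \<delta>) * (r ^ ?d * R ^ ?d) \<le> nT r x * nS R y"
      by (simp add: algebra_simps)
    then have "1 - 3 * \<delta> \<le> ?P"
      unfolding P using rR by (simp add: pos_le_divide_eq)
    with P_le \<delta> show ?thesis by (simp add: abs_le_iff)
  qed
  moreover have "\<rho> > 0" using m \<rho>(1) by linarith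
  ultimately show ?thesis by blast
qed

end

text \<open>With the argument of one factor fixed, the product estimate pins down the other factor up to a
  multiplicative error, uniformly in its argument. Hence both factors are bounded away from 0 and
  uniformly Cauchy, and their limits do not depend on the position.\<close>

lemma uniform_limits_of_product:
  fixes a :: "real \<Rightarrow> 'x \<Rightarrow> real" and b :: "real \<Rightarrow> 'y \<Rightarrow> real"
  assumes nonneg: "\<And>r x. r > 0 \<Longrightarrow> a r x \<ge> 0" "\<And>r y. r > 0 \<Longrightarrow> b r y \<ge> 0"
    and prod: "\<And>\<epsilon>. \<epsilon> > 0 \<Longrightarrow> \<exists>\<rho>>0. \<forall>r\<ge>\<rho>. \<forall>R\<ge>\<rho>. \<forall>x y. \<bar>a r x * b R y - 1\<bar> \<le> \<epsilon>"
  obtains D where "D > 0" "uniform_limit UNIV a (\<lambda>_. D) at_top" "uniform_limit UNIV b (\<lambda>_. 1 / D) at_top"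
proof -
  obtain \<rho>1 where \<rho>1: "\<rho>1 > 0" "\<And>r R x y. r \<ge> \<rho>1 \<Longrightarrow> R \<ge> \<rho>1 \<Longrightarrow> \<bar>a r x * b R y - 1\<bar> \<le> 1/2"
    using prod[of "1/2"] by auto
  \<comment> \<open>Throughout, \<open>undefined\<close> serves as an arbitrary position.\<close>
  define \<alpha> where "\<alpha> = a \<rho>1 undefined"
  define \<beta> where "\<beta> = b \<rho>1 undefined"
  have "\<alpha> * \<beta> \<ge> 1/2" using \<rho>1(2)[of \<rho>1 \<rho>1 undefined undefined]
    unfolding \<alpha>_def \<beta>_def abs_le_iff by simp
  then have "\<alpha> \<noteq> 0" "\<beta> \<noteq> 0" by auto
  then have pos: "\<alpha> > 0" "\<beta> > 0"
    using nonneg(1)[OF \<rho>1(1)] nonneg(2)[OF \<rho>1(1)] by (auto simp: \<alpha>_def \<beta>_def less_le)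
  have a_ge: "a r x \<ge> 1 / (2 * \<beta>)" if "r \<ge> \<rho>1" for r x
  proof -
    have "a r x * \<beta> \<ge> 1/2"
      using \<rho>1(2)[OF that order_refl, of x undefined] unfolding \<beta>_def abs_le_iff by simp
    then show ?thesis using pos by (simp add: field_simps)
  qed
  have b_ge: "b r y \<ge> 1 / (2 * \<alpha>)" if "r \<ge> \<rho>1" for r y
  proof -
    have "\<alpha> * b r y \<ge> 1/2"
      using \<rho>1(2)[OF order_refl that, of undefined y] unfolding \<alpha>_def abs_le_iff by simp
    then show ?thesis using pos by (simp add: field_simps)
  qed
  have a_Cauchy: "\<exists>\<rho>\<ge>\<rho>1. \<forall>r\<ge>\<rho>. \<forall>r'\<ge>\<rho>. \<forall>x x'. \<bar>a r x - a r' x'\<bar> \<le> e" if "e > 0" for e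
  proof -
    have "e / (4 * \<alpha>) > 0" using that pos by simp
    from prod[OF this] obtain \<rho> where \<rho>: "\<rho> > 0" "\<And>r R x y. r \<ge> \<rho> \<Longrightarrow> R \<ge> \<rho> \<Longrightarrow> \<bar>a r x * b R y - 1\<bar> \<le> e / (4 * \<alpha>)"
      by auto
    let ?\<rho> = "max \<rho> \<rho>1"
    have "\<bar>a r x - a r' x'\<bar> \<le> e" if "r \<ge> ?\<rho>" "r' \<ge> ?\<rho>" for r r' x x'
    proof -
      let ?b = "b ?\<rho> undefined"
      have "\<bar>a r x * ?b - a r' x' * ?b\<bar> \<le> e / (4 * \<alpha>) + e / (4 * \<alpha>)"
        using \<rho>(2)[of r ?\<rho> x undefined] \<rho>(2)[of r' ?\<rho> x' undefined] that by (simp add: abs_le_iff)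
      then have "\<bar>a r x - a r' x'\<bar> * \<bar>?b\<bar> \<le> e / (2 * \<alpha>)"
        by (simp add: abs_mult[symmetric] left_diff_distrib)
      moreover have "\<bar>a r x - a r' x'\<bar> * (1 / (2 * \<alpha>)) \<le> \<bar>a r x - a r' x'\<bar> * \<bar>?b\<bar>"
        using b_ge[of ?\<rho> undefined] by (intro mult_left_mono) auto
      ultimately have "\<bar>a r x - a r' x'\<bar> * (1 / (2 * \<alpha>)) \<le> e * (1 / (2 * \<alpha>))" by simp
      then show ?thesis using pos by (simp only: mult_le_cancel_right) auto
    qed
    then show ?thesis by (intro exI[of _ ?\<rho>]) auto
  qed
  have "Cauchy (\<lambda>n. a (real n) undefined)"
  proof (rule CauchyI)
    fix e :: real assume "e > 0"
    then have "e / 2 > 0" by simp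
    from a_Cauchy[OF this] obtain \<rho> where "\<forall>r\<ge>\<rho>. \<forall>r'\<ge>\<rho>. \<forall>x x'. \<bar>a r x - a r' x'\<bar> \<le> e / 2"
      by (elim exE conjE)
    note \<rho> = this[rule_format]
    obtain M where "real M \<ge> \<rho>" using real_arch_simple by blast
    then show "\<exists>M. \<forall>m\<ge>M. \<forall>n\<ge>M. norm (a (real m) undefined - a (real n) undefined) < e"
    proof (intro exI allI impI)
      fix m n assume "m \<ge> M" "n \<ge> M"
      then have "real m \<ge> \<rho>" "real n \<ge> \<rho>" using \<open>real M \<ge> \<rho>\<close> by linarith+
      from \<rho>[OF this, of undefined undefined] \<open>e > 0\<close>
      show "norm (a (real m) undefined - a (real n) undefined) < e" by simp
    qed
  qed
  then obtain D where D: "(\<lambda>n. a (real n) undefined) \<longlonglongrightarrow> D"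
    by (auto simp: Cauchy_convergent_iff convergent_def)
  have large: "\<forall>\<^sub>F n in sequentially. real n \<ge> \<rho>" for \<rho>
    using filterlim_real_sequentially by (simp add: filterlim_at_top)
  have "D \<ge> 1 / (2 * \<beta>)"
  proof (rule tendsto_lowerbound[OF D])
    show "\<forall>\<^sub>F n in sequentially. 1 / (2 * \<beta>) \<le> a (real n) undefined"
      using large[of \<rho>1] by eventually_elim (rule a_ge)
  qed simp
  then have "D > 0" using pos by (auto intro: less_le_trans[rotated])
  moreover have "uniform_limit UNIV a (\<lambda>_. D) at_top"
  proof (rule uniform_limitI)
    fix e :: real assume "e > 0"
    then have "e / 2 > 0" by simp
    from a_Cauchy[OF this] obtain \<rho> where "\<forall>r\<ge>\<rho>. \<forall>r'\<ge>\<rho>. \<forall>x x'. \<bar>a r x - a r' x'\<bar> \<le> e / 2"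
      by (elim exE conjE)
    note \<rho> = this[rule_format]
    have le: "\<bar>a r x - D\<bar> \<le> e / 2" if "r \<ge> \<rho>" for r x
    proof (rule tendsto_upperbound)
      show "(\<lambda>n. \<bar>a r x - a (real n) undefined\<bar>) \<longlonglongrightarrow> \<bar>a r x - D\<bar>"
        by (intro tendsto_intros D)
      show "\<forall>\<^sub>F n in sequentially. \<bar>a r x - a (real n) undefined\<bar> \<le> e / 2"
        using large[of \<rho>] by eventually_elim (use \<rho> that in auto)
    qed simp
    have "\<bar>a r x - D\<bar> < e" if "r \<ge> \<rho>" for r x
      using le[OF that, of x] \<open>e > 0\<close> by simp
    then show "\<forall>\<^sub>F r in at_top. \<forall>x\<in>UNIV. dist (a r x) D < e"
      by (intro eventually_at_top_linorderI[of \<rho>]) (auto simp: dist_real_def)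
  qed
  moreover have "uniform_limit UNIV b (\<lambda>_. 1 / D) at_top"
  proof (rule uniform_limitI)
    fix e :: real assume "e > 0"
    then have "e * D / 2 > 0" using \<open>D > 0\<close> by simp
    from prod[OF this] obtain \<rho> where "\<forall>r\<ge>\<rho>. \<forall>R\<ge>\<rho>. \<forall>x y. \<bar>a r x * b R y - 1\<bar> \<le> e * D / 2"
      by (elim exE conjE)
    note \<rho> = this[rule_format]
    have "\<bar>b R y - 1 / D\<bar> < e" if "R \<ge> \<rho>" for R y
    proof -
      have "\<bar>D * b R y - 1\<bar> \<le> e * D / 2"
      proof (rule tendsto_upperbound)
        show "(\<lambda>n. \<bar>a (real n) undefined * b R y - 1\<bar>) \<longlonglongrightarrow> \<bar>D * b R y - 1\<bar>"
          by (intro tendsto_intros D)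
        show "\<forall>\<^sub>F n in sequentially. \<bar>a (real n) undefined * b R y - 1\<bar> \<le> e * D / 2"
          using large[of \<rho>] by eventually_elim (rule \<rho>[OF _ that])
      qed simp
      also have "\<bar>D * b R y - 1\<bar> = D * \<bar>b R y - 1 / D\<bar>"
        using \<open>D > 0\<close> by (subst abs_of_pos[OF \<open>D > 0\<close>, symmetric], subst abs_mult[symmetric]) (simp add: right_diff_distrib)
      also have "e * D / 2 = D * (e / 2)" by simp
      finally have "\<bar>b R y - 1 / D\<bar> \<le> e / 2"
        using \<open>D > 0\<close> by (simp only: mult_le_cancel_left)
      then show ?thesis using \<open>e > 0\<close> by simp
    qed
    then show "\<forall>\<^sub>F r in at_top. \<forall>x\<in>UNIV. dist (b r x) (1 / D) < e"
      by (intro eventually_at_top_linorderI[of \<rho>]) (auto simp: dist_real_def)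
  qed
  ultimately show ?thesis by (rule that)
qed

lemma (in averaged_counts) densities:
  obtains D where "D > 0" "has_uniform_density T D" "has_uniform_density S (1 / D)"
proof -
  obtain D where D: "D > 0" "uniform_limit UNIV (\<lambda>r x. nT r x / r ^ CARD('d)) (\<lambda>_. D) at_top"
    "uniform_limit UNIV (\<lambda>r x. nS r x / r ^ CARD('d)) (\<lambda>_. 1 / D) at_top"
  proof (rule uniform_limits_of_product)
    show "\<exists>\<rho>>0. \<forall>r\<ge>\<rho>. \<forall>R\<ge>\<rho>. \<forall>x y. \<bar>nT r x / r ^ CARD('d) * (nS R y / R ^ CARD('d)) - 1\<bar> \<le> \<epsilon>"
      if "\<epsilon> > 0" for \<epsilon> by (rule asymptotic_product[OF that])
  qed auto
  with finite_T finite_S show ?thesis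
    by (intro that[of D]) (auto simp: has_uniform_density_def cube_def)
qed

section \<open>Orthogonal exponentials force a sup bound\<close>

lemma L2_indicator:
  assumes "E \<in> sets lborel" "bounded (E :: (real ^ 'd) set)"
  shows "(indicator E :: _ \<Rightarrow> complex) \<in> L2_space" "(L2_norm (indicator E :: _ \<Rightarrow> complex))\<^sup>2 = measure lborel E"
proof -
  have E: "E \<in> sets lebesgue" using assms(1) by auto
  have fin: "emeasure lebesgue E < \<infinity>"
    using emeasure_bounded_finite[OF assms(2)] assms(1) by simp
  have sq: "(cmod (indicator E x))\<^sup>2 = indicator E x" for x
    by (auto split: split_indicator)
  have "integrable lebesgue (\<lambda>x. indicator E x :: real)"
    using E fin by simp
  with E show "(indicator E :: _ \<Rightarrow> complex) \<in> L2_space"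
    by (simp add: L2_space_def sq)
  show "(L2_norm (indicator E :: _ \<Rightarrow> complex))\<^sup>2 = measure lborel E"
    using E assms(1) by (simp add: L2_norm_power2 sq measure_completion)
qed

lemma L2_indicator_times_cnj:
  assumes "E \<in> sets lborel" and h: "h \<in> L2_space"
  shows "(\<lambda>x. indicator E x * cnj (h x)) \<in> L2_space"
proof -
  have E: "E \<in> sets lebesgue" using assms(1) by auto
  have hm: "h \<in> borel_measurable lebesgue" using h by (simp add: L2_space_def)
  have m: "(\<lambda>x. indicator E x * cnj (h x)) \<in> borel_measurable lebesgue"
    by (intro borel_measurable_times borel_measurable_indicator E borel_measurable_cnj hm)
  have "integrable lebesgue (\<lambda>x. (cmod (indicator E x * cnj (h x)))\<^sup>2)"
  proof (rule Bochner_Integration.integrable_bound)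
    show "integrable lebesgue (\<lambda>x. (cmod (h x))\<^sup>2)" using h by (simp add: L2_space_def)
    show "(\<lambda>x. (cmod (indicator E x * cnj (h x)))\<^sup>2) \<in> borel_measurable lebesgue"
      using m by measurable
  qed (auto split: split_indicator)
  with m show ?thesis by (simp add: L2_space_def)
qed

text \<open>For \<open>f\<close> the indicator of a bounded set \<open>E\<close>, the inner product of \<open>M\<^sub>y f\<close> with \<open>M\<^sub>s h\<close> is the Fourier
  transform at \<open>s - y\<close> of \<open>f\<close> times the conjugate of \<open>h\<close>. Averaging Bessel's inequality over \<open>y\<close>
  replaces the sum over \<open>\<Lambda>\<close> by \<open>D\<close> times an integral, which Plancherel's theorem evaluates to
  \<open>\<integral>\<^sub>E \<bar>h\<bar>\<^sup>2\<close>. The resulting inequality \<open>D \<integral>\<^sub>E \<bar>h\<bar>\<^sup>2 \<le> \<bar>E\<bar>\<close> is contradictory if \<open>E\<close> has positive measure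
  and \<open>\<bar>h\<bar>\<^sup>2 > 1 / D\<close> on \<open>E\<close>.\<close>

lemma AE_bound_of_averaged_Bessel:
  fixes h :: "real ^ 'd \<Rightarrow> complex"
  assumes h: "h \<in> L2_space" and "countable \<Lambda>"
    and on: "\<And>s s'. s \<in> \<Lambda> \<Longrightarrow> s' \<in> \<Lambda> \<Longrightarrow>
      L2_inner (\<lambda>x. h x * char_fun (s \<bullet> x)) (\<lambda>x. h x * char_fun (s' \<bullet> x)) = (if s = s' then 1 else 0)"
    and dens: "has_uniform_density \<Lambda> D" and "D > 0"
  shows "AE x in lebesgue. (cmod (h x))\<^sup>2 \<le> 1 / D"
proof -
  obtain h' where h'm [measurable]: "h' \<in> borel_measurable borel" and h': "h' \<in> L2_space"
    and ae: "AE x in lebesgue. h x = h' x"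
    using L2_borel_representative[OF h] .
  \<comment> \<open>The restriction to a ball makes the indicator of \<open>E n\<close> square integrable.\<close>
  define E where "E n = {x :: real ^ 'd. norm x \<le> real n \<and> (cmod (h' x))\<^sup>2 > 1 / D}" for n
  have null: "AE x in lborel. x \<notin> E n" for n
  proof -
    have Em [measurable]: "E n \<in> sets borel"
      unfolding E_def by measurable
    have Eb: "bounded (E n)"
      by (rule bounded_subset[of "cball 0 (real n)"]) (auto simp: E_def)
    let ?f = "indicator (E n) :: _ \<Rightarrow> complex"
    note f = L2_indicator[of "E n", simplified, OF Eb]
    define k where "k x = ?f x * cnj (h' x)" for x
    have km: "k \<in> borel_measurable borel" unfolding k_def[abs_def] by measurable
    have k1: "integrable lebesgue k"
      unfolding k_def[abs_def] by (rule L2_inner_integrable[OF f(1) h'])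
    have k2: "k \<in> L2_space"
      unfolding k_def[abs_def] by (rule L2_indicator_times_cnj[OF _ h']) simp
    define \<psi> where "\<psi> w = ennreal ((cmod (fourier_L1 k w))\<^sup>2)" for w
    have [measurable]: "\<psi> \<in> borel_measurable borel"
      unfolding \<psi>_def[abs_def] using fourier_L1_measurable[OF km] by measurable
    have mass: "(\<integral>\<^sup>+w. \<psi> w \<partial>lborel) = ennreal ((L2_norm k)\<^sup>2)"
      using nn_integral_L2[OF Plancherel(1)[OF k1 k2]] Plancherel(2)[OF k1 k2]
      by (simp add: \<psi>_def nn_integral_completion)
    have Bessel: "(\<integral>\<^sup>+s. \<psi> (s - y) \<partial>count_space \<Lambda>) \<le> ennreal (measure lborel (E n))" for y
    proof (rule nn_integral_count_space_le[OF \<open>countable \<Lambda>\<close>])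
      fix F assume F: "finite F" "F \<subseteq> \<Lambda>"
      let ?fy = "\<lambda>x. ?f x * char_fun (y \<bullet> x)" and ?M = "\<lambda>s x. h x * char_fun (s \<bullet> x)"
      have inner: "L2_inner ?fy (?M s) = fourier_L1 k (s - y)" for s
      proof -
        have "L2_inner ?fy (?M s) = L2_inner ?fy (\<lambda>x. h' x * char_fun (s \<bullet> x))"
          by (rule L2_inner_cong_AE)
            (use ae in \<open>auto intro!: L2_modulate f h h' elim: eventually_mono\<close>)
        also have "\<dots> = fourier_L1 k (s - y)"
          unfolding L2_inner_def fourier_L1_eq k_def
        proof (intro Bochner_Integration.integral_cong refl)
          fix x
          have "char_fun (- ((s - y) \<bullet> x)) = char_fun (y \<bullet> x) * cnj (char_fun (s \<bullet> x))"
            by (simp add: cis_cnj cis_mult inner_diff_left right_diff_distrib)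
          then show "?f x * char_fun (y \<bullet> x) * cnj (h' x * char_fun (s \<bullet> x)) =
              ?f x * cnj (h' x) * char_fun (- ((s - y) \<bullet> x))"
            by simp
        qed
        finally show ?thesis .
      qed
      have "(\<Sum>s\<in>F. (cmod (L2_inner ?fy (?M s)))\<^sup>2) \<le> (L2_norm ?fy)\<^sup>2"
      proof (rule L2_Bessel[OF F(1)])
        show "L2_inner (?M s) (?M s') = (if s = s' then 1 else 0)" if "s \<in> F" "s' \<in> F" for s s'
          using on[of s s'] that F(2) by blast
      qed (intro L2_modulate f h)+
      then have "(\<Sum>s\<in>F. (cmod (fourier_L1 k (s - y)))\<^sup>2) \<le> measure lborel (E n)"
        by (simp add: inner L2_norm_modulate f(2))
      then show "(\<Sum>s\<in>F. \<psi> (s - y)) \<le> ennreal (measure lborel (E n))"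
        by (simp add: \<psi>_def sum_ennreal ennreal_leI)
    qed
    have main: "(D - e) * (L2_norm k)\<^sup>2 \<le> measure lborel (E n)" if "e > 0" "e < D" for e
    proof -
      let ?N = "\<lambda>r x. real (card (\<Lambda> \<inter> cbox x (x + (\<chi> i. r))))"
      have "\<forall>\<^sub>F r in at_top. \<forall>x\<in>UNIV. dist (?N r x / r ^ CARD('d)) D < e"
        using dens \<open>e > 0\<close> unfolding has_uniform_density_def by (auto dest: uniform_limitD)
      with eventually_gt_at_top[of 0]
      have "\<forall>\<^sub>F r in at_top. r > 0 \<and> (\<forall>x. dist (?N r x / r ^ CARD('d)) D < e)"
        by eventually_elim simp
      then obtain r where r: "r > 0" "\<And>x. dist (?N r x / r ^ CARD('d)) D < e"
        by (auto simp: eventually_at_top_linorder)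
      have count: "ennreal ((D - e) * r ^ CARD('d)) \<le> count_in \<Lambda> (cube x r)" for x
      proof -
        have "D - e \<le> ?N r x / r ^ CARD('d)"
          using r(2)[of x] by (simp add: dist_real_def abs_less_iff)
        then have "(D - e) * r ^ CARD('d) \<le> ?N r x"
          using r(1) by (simp add: pos_le_divide_eq)
        moreover have "finite (\<Lambda> \<inter> cube x r)"
          using dens by (simp add: has_uniform_density_def cube_def)
        ultimately show ?thesis
          by (simp add: count_in_eq cube_def ennreal_leI)
      qed
      have "ennreal ((D - e) * r ^ CARD('d)) * ennreal ((L2_norm k)\<^sup>2) =
          (\<integral>\<^sup>+w. \<psi> w * ennreal ((D - e) * r ^ CARD('d)) \<partial>lborel)"
        by (simp add: nn_integral_multc mass mult.commute)
      also have "\<dots> \<le> (\<integral>\<^sup>+w. \<psi> w * count_in \<Lambda> {l. l - w \<in> cube 0 r} \<partial>lborel)"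
      proof (rule nn_integral_mono)
        fix w :: "real ^ 'd"
        have "{l. l - w \<in> cube 0 r} = cube w r"
          by (auto simp: mem_cube algebra_simps)
        then show "\<psi> w * ennreal ((D - e) * r ^ CARD('d)) \<le> \<psi> w * count_in \<Lambda> {l. l - w \<in> cube 0 r}"
          using count[of w] by (simp add: mult_left_mono)
      qed
      also have "\<dots> = (\<integral>\<^sup>+z. indicator (cube 0 r) z * (\<integral>\<^sup>+l. \<psi> (l - z) \<partial>count_space \<Lambda>) \<partial>lborel)"
        by (rule averaged_periodization[symmetric]) (use \<open>countable \<Lambda>\<close> in measurable)
      also have "\<dots> \<le> (\<integral>\<^sup>+z. indicator (cube (0 :: real ^ 'd) r) z * ennreal (measure lborel (E n)) \<partial>lborel)"
        by (intro nn_integral_mono mult_left_mono Bessel) simp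
      also have "\<dots> = ennreal (r ^ CARD('d)) * ennreal (measure lborel (E n))"
        using r(1) by (simp add: nn_integral_multc emeasure_cube)
      finally have "ennreal ((D - e) * r ^ CARD('d) * (L2_norm k)\<^sup>2) \<le> ennreal (r ^ CARD('d) * measure lborel (E n))"
        using r(1) that by (simp add: ennreal_mult)
      then have "(D - e) * r ^ CARD('d) * (L2_norm k)\<^sup>2 \<le> r ^ CARD('d) * measure lborel (E n)"
        using r(1) by (subst (asm) ennreal_le_iff) auto
      then have "r ^ CARD('d) * ((D - e) * (L2_norm k)\<^sup>2) \<le> r ^ CARD('d) * measure lborel (E n)"
        by (simp add: mult_ac)
      then show ?thesis using r(1) by (simp only: mult_le_cancel_left_pos zero_less_power)
    qed
    have "D * (L2_norm k)\<^sup>2 \<le> measure lborel (E n)"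
    proof (rule tendsto_upperbound)
      have "((\<lambda>e. (D - e) * (L2_norm k)\<^sup>2) \<longlongrightarrow> (D - 0) * (L2_norm k)\<^sup>2) (at_right 0)"
        by (intro tendsto_intros)
      then show "((\<lambda>e. (D - e) * (L2_norm k)\<^sup>2) \<longlongrightarrow> D * (L2_norm k)\<^sup>2) (at_right 0)" by simp
      show "\<forall>\<^sub>F e in at_right 0. (D - e) * (L2_norm k)\<^sup>2 \<le> measure lborel (E n)"
        using eventually_at_right_less[of 0] eventually_at_right_real[OF \<open>D > 0\<close>]
        by eventually_elim (simp add: main)
    qed simp
    moreover have "(L2_norm k)\<^sup>2 = (\<integral>x. (cmod (k x))\<^sup>2 \<partial>lborel)"
      unfolding L2_norm_power2 by (rule integral_completion) (use km in measurable)
    ultimately have le: "D * (\<integral>x. (cmod (k x))\<^sup>2 \<partial>lborel) \<le> measure lborel (E n)" by simp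
    let ?w = "\<lambda>x. D * (cmod (k x))\<^sup>2 - indicator (E n) x :: real"
    have ik: "integrable lborel (\<lambda>x. (cmod (k x))\<^sup>2)"
    proof -
      have "(\<lambda>x. (cmod (k x))\<^sup>2) \<in> borel_measurable lborel" using km by measurable
      with k2 show ?thesis by (simp add: L2_space_def integrable_completion)
    qed
    have iE: "integrable lborel (indicator (E n) :: _ \<Rightarrow> real)"
      using emeasure_bounded_finite[OF Eb] by simp
    have w_int: "integrable lborel ?w"
      using ik iE by simp
    have w_pos: "x \<in> E n \<Longrightarrow> ?w x > 0" "x \<notin> E n \<Longrightarrow> ?w x = 0" for x
      using \<open>D > 0\<close> by (auto simp: k_def E_def field_simps split: split_indicator)
    have w_nonneg: "?w x \<ge> 0" for x
      using w_pos(1)[THEN less_imp_le, of x] w_pos(2)[THEN eq_refl[OF sym], of x] by blast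
    have "(\<integral>x. ?w x \<partial>lborel) \<le> 0"
      using le ik iE by simp
    then have "(\<integral>x. ?w x \<partial>lborel) = 0"
      by (intro antisym Bochner_Integration.integral_nonneg w_nonneg)
    then have "AE x in lborel. ?w x = 0"
      using integral_nonneg_eq_0_iff_AE[OF w_int] w_nonneg by auto
    then show ?thesis
      by eventually_elim (use w_pos(1) in force)
  qed
  then have "AE x in lborel. \<forall>n. x \<notin> E n"
    by (simp add: AE_all_countable)
  then have "AE x in lborel. (cmod (h' x))\<^sup>2 \<le> 1 / D"
  proof eventually_elim
    case (elim x)
    obtain n where "norm x \<le> real n" using real_arch_simple by blast
    with elim show ?case by (auto simp: E_def not_less)
  qed
  then have "AE x in lebesgue. (cmod (h' x))\<^sup>2 \<le> 1 / D"
    by (rule AE_completion)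
  with ae show ?thesis by eventually_elim simp
qed

section \<open>Gabor bases\<close>

lemma gabor_eq: "gabor g (t, s) = (\<lambda>x. g (x - t) * char_fun (s \<bullet> x))"
  by (simp add: gabor_def cis_conv_exp fun_eq_iff mult_ac)

lemma AE_lebesgue_translation:
  fixes a :: "'a :: euclidean_space"
  assumes "AE x in lebesgue. P x"
  shows "AE x in lebesgue. P (x + a)"
proof -
  have "AE x in distr lebesgue lebesgue (\<lambda>x. x + a). P x"
    unfolding lebesgue_distr_translation(2) by (rule assms)
  from AE_distrD[OF lebesgue_distr_translation(1) this] show ?thesis .
qed

text \<open>With \<open>f\<close> the indicator of the unit cube, \<open>\<phi> (u, v)\<close> is the squared modulus of the inner product of
  \<open>f\<close> with \<open>M\<^sub>v T\<^sub>u g\<close>. The choice of \<open>f\<close> as a bounded function makes \<open>f\<close> times the conjugate of \<open>T\<^sub>u g\<close>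
  a function in \<open>L\<^sup>1 \<inter> L\<^sup>2\<close> for every \<open>u\<close>, so that Plancherel's theorem applies in \<open>v\<close>. The periodization
  of \<open>\<phi>\<close> along \<open>T \<times> S\<close> is constant since \<open>\<phi> ((t, s) - (a, b))\<close> is the squared modulus of a coefficient
  of \<open>M\<^sub>b T\<^sub>a f\<close>.\<close>

lemma gabor_averaged_counts:
  fixes g :: "real ^ 'd \<Rightarrow> complex" and T S :: "(real ^ 'd) set"
  assumes g: "g \<in> L2_space" and countable: "countable T" "countable S"
    and onb: "L2_orthonormal_basis (T \<times> S) (gabor g)" and norm: "L2_norm g = 1"
  shows "\<exists>\<phi>. averaged_counts T S \<phi>"
proof -
  obtain g' where g'm [measurable]: "g' \<in> borel_measurable borel" and g': "g' \<in> L2_space"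
    and ae: "AE x in lebesgue. g x = g' x"
    using L2_borel_representative[OF g] .
  have norm': "(L2_norm g')\<^sup>2 = 1"
  proof -
    have "L2_inner g' g' = L2_inner g g"
      using ae by (intro L2_inner_cong_AE g g') (auto elim: eventually_mono)
    then show ?thesis using norm by (simp only: L2_inner_self of_real_eq_iff) simp
  qed
  let ?f = "indicator (cube 0 1) :: real ^ 'd \<Rightarrow> complex"
  have f: "?f \<in> L2_space" "(L2_norm ?f)\<^sup>2 = 1"
    using L2_indicator[of "cube (0 :: real ^ 'd) 1"] emeasure_cube[of 1 "0 :: real ^ 'd"]
    by (auto simp: cube_def measure_def)
  have fm [measurable]: "?f \<in> borel_measurable borel" by measurable
  define k where "k u x = ?f x * cnj (g' (x - u))" for u x :: "real ^ 'd"
  have km: "k u \<in> borel_measurable borel" for u unfolding k_def by measurable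
  have k1: "integrable lebesgue (k u)" for u
    unfolding k_def by (rule L2_inner_integrable[OF f(1) L2_translate[OF g']])
  have k2: "k u \<in> L2_space" for u
    unfolding k_def by (rule L2_indicator_times_cnj[OF _ L2_translate[OF g']]) simp
  define \<phi> where "\<phi> w = ennreal ((cmod (fourier_L1 (k (fst w)) (snd w)))\<^sup>2)" for w
  have \<phi>m': "\<phi> \<in> borel_measurable (borel \<Otimes>\<^sub>M borel)"
    unfolding \<phi>_def[abs_def] fourier_L1_borel[OF km] k_def by measurable
  then have \<phi>m: "\<phi> \<in> borel_measurable borel" by (simp add: borel_prod)
  have "averaged_counts T S \<phi>"
  proof
    show "\<phi> \<in> borel_measurable borel" by (rule \<phi>m)
    have "(\<integral>\<^sup>+w. \<phi> w \<partial>lborel) = (\<integral>\<^sup>+u. \<integral>\<^sup>+v. \<phi> (u, v) \<partial>lborel \<partial>lborel)"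
      using \<phi>m' by (subst lborel_prod[symmetric], subst lborel.nn_integral_fst[symmetric]) auto
    also have "\<dots> = (\<integral>\<^sup>+u. \<integral>\<^sup>+x. ennreal ((cmod (k u x))\<^sup>2) \<partial>lborel \<partial>lborel)"
    proof (rule nn_integral_cong)
      fix u
      have "(\<integral>\<^sup>+v. \<phi> (u, v) \<partial>lborel) = ennreal ((L2_norm (fourier_L1 (k u)))\<^sup>2)"
        unfolding \<phi>_def fst_conv snd_conv nn_integral_L2[OF Plancherel(1)[OF k1 k2], symmetric]
        by (simp add: nn_integral_completion)
      also have "\<dots> = (\<integral>\<^sup>+x. ennreal ((cmod (k u x))\<^sup>2) \<partial>lborel)"
        unfolding Plancherel(2)[OF k1 k2] nn_integral_L2[OF k2, symmetric] by (simp add: nn_integral_completion)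
      finally show "(\<integral>\<^sup>+v. \<phi> (u, v) \<partial>lborel) = (\<integral>\<^sup>+x. ennreal ((cmod (k u x))\<^sup>2) \<partial>lborel)" .
    qed
    also have "\<dots> = (\<integral>\<^sup>+x. \<integral>\<^sup>+u. ennreal ((cmod (k u x))\<^sup>2) \<partial>lborel \<partial>lborel)"
      by (rule lborel_pair.Fubini') (unfold k_def, measurable)
    also have "\<dots> = (\<integral>\<^sup>+x. indicator (cube (0 :: real ^ 'd) 1) x \<partial>lborel)"
    proof (rule nn_integral_cong)
      fix x :: "real ^ 'd"
      have "(\<integral>\<^sup>+u. ennreal ((cmod (g' (x - u)))\<^sup>2) \<partial>lborel) = (\<integral>\<^sup>+u. ennreal ((cmod (g' u))\<^sup>2) \<partial>lborel)"
        by (rule nn_integral_lborel_reflect) measurable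
      also have "\<dots> = 1"
        using nn_integral_L2[OF g'] norm' by (simp add: nn_integral_completion)
      finally show "(\<integral>\<^sup>+u. ennreal ((cmod (k u x))\<^sup>2) \<partial>lborel) = indicator (cube 0 1) x"
        by (auto simp: k_def split: split_indicator)
    qed
    also have "\<dots> = 1" by (simp add: emeasure_cube)
    finally show "(\<integral>\<^sup>+w. \<phi> w \<partial>lborel) = 1" .
    have periodic: "(\<integral>\<^sup>+l. \<phi> (l - z) \<partial>count_space (T \<times> S)) = 1" for z
    proof -
      obtain a b where z: "z = (a, b)" by (cases z)
      let ?fz = "\<lambda>x. ?f (x - a) * char_fun (b \<bullet> x)"
      have fz: "?fz \<in> L2_space" "(L2_norm ?fz)\<^sup>2 = 1"
        using L2_translate[OF f(1), of a] by (auto intro: L2_modulate simp: L2_norm_modulate L2_norm_translate f)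
      have "\<phi> (l - z) = ennreal ((cmod (L2_inner ?fz (gabor g l)))\<^sup>2)" for l
      proof -
        obtain t s where l: "l = (t, s)" by (cases l)
        have "AE x in lebesgue. g (x - t) = g' (x - t)"
          using AE_lebesgue_translation[OF ae, of "- t"] by simp
        then have "L2_inner ?fz (gabor g l) = L2_inner ?fz (gabor g' l)"
          unfolding l gabor_eq
          by (intro L2_inner_cong_AE fz L2_modulate L2_translate g g') (auto elim: eventually_mono)
        also have "\<dots> = (\<integral>x. ?fz (x + a) * cnj (gabor g' l (x + a)) \<partial>lebesgue)"
          unfolding L2_inner_def
          by (rule lebesgue_integral_translation[symmetric], rule borel_measurable_integrable, rule L2_inner_integrable)
            (auto simp: l gabor_eq intro!: fz L2_modulate L2_translate g')
        also have "\<dots> = (\<integral>x. char_fun ((b - s) \<bullet> a) * (k (t - a) x * char_fun (- ((s - b) \<bullet> x))) \<partial>lebesgue)"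
        proof (intro Bochner_Integration.integral_cong refl)
          fix x
          have "char_fun (b \<bullet> (x + a)) * cnj (char_fun (s \<bullet> (x + a))) =
              char_fun ((b - s) \<bullet> a) * char_fun (- ((s - b) \<bullet> x))"
            by (simp add: cis_cnj cis_mult inner_diff_left inner_add_right algebra_simps)
          moreover have "k (t - a) x = ?f x * cnj (g' (x + a - t))"
            by (simp add: k_def algebra_simps)
          moreover have "?fz (x + a) * cnj (gabor g' l (x + a)) =
              ?f x * cnj (g' (x + a - t)) * (char_fun (b \<bullet> (x + a)) * cnj (char_fun (s \<bullet> (x + a))))"
            by (simp add: l gabor_eq)
          ultimately show "?fz (x + a) * cnj (gabor g' l (x + a)) =
            char_fun ((b - s) \<bullet> a) * (k (t - a) x * char_fun (- ((s - b) \<bullet> x)))"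
            by (simp only: mult_ac)
        qed
        also have "\<dots> = char_fun ((b - s) \<bullet> a) * fourier_L1 (k (t - a)) (s - b)"
          by (simp only: integral_mult_right_zero fourier_L1_eq)
        finally show ?thesis by (simp add: \<phi>_def l z norm_mult)
      qed
      then show ?thesis
        using L2_Parseval[OF countable_SIGMA[OF countable(1), of "\<lambda>_. S"] onb fz(1)] countable(2) fz(2) by simp
    qed
    fix x y :: "real ^ 'd" and r R :: real
    assume rR: "r \<ge> 0" "R \<ge> 0"
    let ?Q = "cube x r \<times> cube y R"
    have Q: "?Q \<in> sets borel" by (intro borel_Times cube_measurable)
    have "(\<integral>\<^sup>+w. \<phi> w * (count_in T (cube (x + fst w) r) * count_in S (cube (y + snd w) R)) \<partial>lborel) =
        (\<integral>\<^sup>+w. \<phi> w * count_in (T \<times> S) {l. l - w \<in> ?Q} \<partial>lborel)"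
    proof (rule nn_integral_cong)
      fix w :: "(real ^ 'd) \<times> (real ^ 'd)"
      have "{l. l - w \<in> ?Q} = cube (x + fst w) r \<times> cube (y + snd w) R"
        by (cases w) (auto simp: mem_cube algebra_simps)
      then show "\<phi> w * (count_in T (cube (x + fst w) r) * count_in S (cube (y + snd w) R)) =
          \<phi> w * count_in (T \<times> S) {l. l - w \<in> ?Q}"
        by (simp add: count_in_Times)
    qed
    also have "\<dots> = (\<integral>\<^sup>+z. indicator ?Q z * (\<integral>\<^sup>+l. \<phi> (l - z) \<partial>count_space (T \<times> S)) \<partial>lborel)"
      by (rule averaged_periodization[symmetric, OF _ \<phi>m Q]) (intro countable_SIGMA countable)
    also have "\<dots> = emeasure lborel ?Q"
      using Q by (simp add: periodic)
    also have "\<dots> = ennreal (r ^ CARD('d) * R ^ CARD('d))"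
      using rR by (subst lborel_prod[symmetric], subst lborel.emeasure_pair_measure_Times)
        (auto simp: emeasure_cube ennreal_mult)
    finally show "(\<integral>\<^sup>+w. \<phi> w * (count_in T (cube (x + fst w) r) * count_in S (cube (y + snd w) R)) \<partial>lborel) =
      ennreal (r ^ CARD('d) * R ^ CARD('d))" .
  qed
  then show ?thesis by blast
qed

lemma Linf_norm_le:
  assumes "h \<in> borel_measurable lebesgue" "AE x in lebesgue. (cmod (h x))\<^sup>2 \<le> B"
  shows "h \<in> Linf_space" "Linf_norm h \<le> ereal (sqrt B)"
proof -
  show le: "Linf_norm h \<le> ereal (sqrt B)"
    unfolding Linf_norm_def
  proof (rule esssup_I)
    show "(\<lambda>x. ereal (cmod (h x))) \<in> borel_measurable lebesgue" using assms(1) by measurable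
    show "AE x in lebesgue. ereal (cmod (h x)) \<le> ereal (sqrt B)"
      using assms(2) by eventually_elim (simp add: real_le_rsqrt)
  qed
  show "h \<in> Linf_space"
    using assms(1) le_less_trans[OF le, of \<infinity>] by (simp add: Linf_space_def)
qed

theorem corollary1p3:
  fixes g :: "real ^ 'd \<Rightarrow> complex" and T S :: "(real ^ 'd) set"
  assumes "g \<in> L2_space"
    and "countable T" and "countable S"
    and "L2_orthonormal_basis (T \<times> S) (gabor g)"
  shows "g \<in> Linf_space \<and> fourier_L2 g \<in> Linf_space \<and>
    Linf_norm g \<le> ereal (sqrt (uniform_density T)) \<and>
    Linf_norm (fourier_L2 g) \<le> ereal (sqrt (uniform_density S))"
proof -
  note g = assms(1) and countable = assms(2,3) and onb = assms(4)
  have on: "L2_inner (gabor g i) (gabor g j) = (if i = j then 1 else 0)" if "i \<in> T \<times> S" "j \<in> T \<times> S" for i j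
    using onb that unfolding L2_orthonormal_basis_def by blast
  have "T \<times> S \<noteq> {}"
  proof
    assume empty: "T \<times> S = {}"
    have "(indicator (cube 0 1) :: real ^ 'd \<Rightarrow> complex) \<in> L2_space"
      by (rule L2_indicator) (simp_all add: cube_def)
    from L2_Parseval[OF _ onb this]
    have "(L2_norm (indicator (cube 0 1) :: real ^ 'd \<Rightarrow> complex))\<^sup>2 = 0"
      unfolding empty by (simp add: nn_integral_count_space_finite)
    then show False
      using L2_indicator(2)[of "cube (0 :: real ^ 'd) 1"] emeasure_cube[of 1 "0 :: real ^ 'd"]
      by (simp add: cube_def measure_def)
  qed
  then obtain t0 s0 where t0: "t0 \<in> T" and s0: "s0 \<in> S" by auto
  have modulations: "L2_inner (\<lambda>x. g x * char_fun (s \<bullet> x)) (\<lambda>x. g x * char_fun (s' \<bullet> x)) = (if s = s' then 1 else 0)"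
    if "s \<in> S" "s' \<in> S" for s s'
  proof -
    let ?M = "\<lambda>s x. g x * char_fun (s \<bullet> x)"
    have e: "gabor g (t0, s) = (\<lambda>x. char_fun (s \<bullet> t0) * ?M s (x - t0))" for s
      by (simp add: gabor_eq fun_eq_iff cis_mult inner_diff_right algebra_simps)
    have "L2_inner (gabor g (t0, s)) (gabor g (t0, s')) =
        char_fun (s \<bullet> t0) * cnj (char_fun (s' \<bullet> t0)) * L2_inner (\<lambda>x. ?M s (x - t0)) (\<lambda>x. ?M s' (x - t0))"
      unfolding e L2_inner_scale_left by (subst (1 2) L2_inner_commute) (simp add: L2_inner_scale_left)
    also have "\<dots> = char_fun (s \<bullet> t0) * cnj (char_fun (s' \<bullet> t0)) * L2_inner (?M s) (?M s')"
      by (simp only: L2_inner_translate[OF L2_modulate[OF g] L2_modulate[OF g]])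
    finally have "char_fun (s \<bullet> t0) * cnj (char_fun (s' \<bullet> t0)) * L2_inner (?M s) (?M s') = (if s = s' then 1 else 0)"
      using on[of "(t0, s)" "(t0, s')"] that t0 by simp
    then show ?thesis
      by (cases "s = s'") (auto simp: cis_cnj cis_mult)
  qed
  have translates: "L2_inner (\<lambda>x. g (x - t)) (\<lambda>x. g (x - t')) = (if t = t' then 1 else 0)"
    if "t \<in> T" "t' \<in> T" for t t'
  proof -
    have "L2_inner (\<lambda>x. g (x - t)) (\<lambda>x. g (x - t')) = L2_inner (gabor g (t, s0)) (gabor g (t', s0))"
      unfolding L2_inner_def gabor_eq
    proof (intro Bochner_Integration.integral_cong refl)
      fix x
      have "g (x - t) * char_fun (s0 \<bullet> x) * cnj (g (x - t') * char_fun (s0 \<bullet> x)) =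
          g (x - t) * cnj (g (x - t')) * (char_fun (s0 \<bullet> x) * cnj (char_fun (s0 \<bullet> x)))"
        by (simp only: complex_cnj_mult mult_ac)
      also have "char_fun (s0 \<bullet> x) * cnj (char_fun (s0 \<bullet> x)) = 1" by (simp add: cis_cnj cis_mult)
      finally show "g (x - t) * cnj (g (x - t')) =
          g (x - t) * char_fun (s0 \<bullet> x) * cnj (g (x - t') * char_fun (s0 \<bullet> x))"
        by simp
    qed
    with on[of "(t, s0)" "(t', s0)"] that s0 show ?thesis by simp
  qed
  have "L2_inner g g = 1"
    using translates[OF t0 t0] L2_inner_translate[OF g g, of t0] by simp
  then have "(L2_norm g)\<^sup>2 = 1\<^sup>2" by (metis L2_inner_self of_real_eq_1_iff one_power2)
  then have "L2_norm g = 1" by (simp add: power2_eq_imp_eq)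
  from gabor_averaged_counts[OF g countable onb this] obtain \<phi> where "averaged_counts T S \<phi>" by blast
  then obtain D where D: "D > 0" "has_uniform_density T D" "has_uniform_density S (1 / D)"
    using averaged_counts.densities by blast
  have dens: "uniform_density T = D" "uniform_density S = 1 / D"
    using D by (auto intro: uniform_density_eqI)
  have "AE x in lebesgue. (cmod (g x))\<^sup>2 \<le> 1 / (1 / D)"
    using D(1) by (intro AE_bound_of_averaged_Bessel[OF g countable(2) modulations D(3)]) auto
  moreover have "g \<in> borel_measurable lebesgue" using g by (simp add: L2_space_def)
  ultimately have g_bound: "g \<in> Linf_space" "Linf_norm g \<le> ereal (sqrt D)"
    using Linf_norm_le[of g D] by simp_all
  define h where "h = fourier_L2 g"
  have h: "is_fourier_L2 g h" unfolding h_def by (rule is_fourier_L2_fourier_L2[OF g])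
  then have h2: "h \<in> L2_space" by (simp add: is_fourier_L2_def)
  then have hm: "h \<in> borel_measurable lebesgue" by (simp add: L2_space_def)
  \<comment> \<open>Conjugating the transform replaces the frequencies \<open>- t\<close> by \<open>t\<close>, so the density of \<open>T\<close> itself enters
    and not that of its reflection.\<close>
  have ch2: "(\<lambda>\<xi>. cnj (h \<xi>)) \<in> L2_space"
    using h2 borel_measurable_cnj[OF hm] by (simp add: L2_space_def)
  have "L2_inner (\<lambda>\<xi>. cnj (h \<xi>) * char_fun (t \<bullet> \<xi>)) (\<lambda>\<xi>. cnj (h \<xi>) * char_fun (t' \<bullet> \<xi>)) = (if t = t' then 1 else 0)"
    if "t \<in> T" "t' \<in> T" for t t'
  proof -
    have "L2_inner (\<lambda>\<xi>. cnj (h \<xi>) * char_fun (t \<bullet> \<xi>)) (\<lambda>\<xi>. cnj (h \<xi>) * char_fun (t' \<bullet> \<xi>)) =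
        L2_inner (\<lambda>\<xi>. h \<xi> * char_fun (- t' \<bullet> \<xi>)) (\<lambda>\<xi>. h \<xi> * char_fun (- t \<bullet> \<xi>))"
      unfolding L2_inner_def
      by (intro Bochner_Integration.integral_cong refl) (simp add: cis_cnj mult_ac)
    also have "\<dots> = (if t = t' then 1 else 0)"
      unfolding fourier_L2_inner_translates[OF g h] translates[OF that(2,1)] by auto
    finally show ?thesis .
  qed
  then have "AE \<xi> in lebesgue. (cmod (cnj (h \<xi>)))\<^sup>2 \<le> 1 / D"
    by (intro AE_bound_of_averaged_Bessel[OF ch2 countable(1) _ D(2,1)])
  then have "h \<in> Linf_space" "Linf_norm h \<le> ereal (sqrt (1 / D))"
    using Linf_norm_le[OF hm, of "1 / D"] by simp_all
  with g_bound show ?thesis by (simp add: dens h_def)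
qed

end
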